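(* Let $q$ be a prime power, $n\ge 1$, let $G=\operatorname{GU}(n,q)$ be the unitary group of a nondegenerate Hermitian form on $V=\mathbb{F}_{q^2}^n$, and let $C$ be a conjugacy class of $G$ with representative $g$. Let $o(C)$ be the number of orbits of the centralizer $C_G(g)$ on the quotient $V/[g,V]$, where $[g,V]=(I-g)V$. Let $\lambda=\lambda_{z-1}(C)$ be the partition whose parts are the sizes of the Jordan blocks of $g$ for the eigenvalue $1$ (the empty partition if $1$ is not an eigenvalue). Then \[ o(C)=1+q\,d(\lambda)-b(\lambda), \] where $d(\lambda)$ is the number of distinct part sizes of $\lambda$ and $b(\lambda)$ is the number of part sizes of $\lambda$ that occur with multiplicity exactly $1$.
   Context: $o(C)$ depends only on the conjugacy class $C$, not on the choice of $g\in C$. For the empty partition, $d=b=0$. *)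

theory Defs
  imports
    "Jordan_Normal_Form.Jordan_Normal_Form"
    "HOL-Algebra.AbelCoset"
    "HOL-Algebra.Group_Action"
    "HOL-Number_Theory.Prime_Powers"
begin

text \<open>
  The field \<open>'a\<close> is meant to have \<open>q\<^sup>2\<close> elements, so that \<open>x \<mapsto> x ^ q\<close> is its involution fixing
  the subfield with \<open>q\<close> elements. Semilinearity in the second argument follows from linearity in
  the first one and the symmetry condition.
\<close>

definition hermitian_form :: "nat \<Rightarrow> nat \<Rightarrow> ('a::field vec \<Rightarrow> 'a vec \<Rightarrow> 'a) \<Rightarrow> bool" where
  "hermitian_form q n f \<longleftrightarrow>
     (\<forall>u\<in>carrier_vec n. \<forall>v\<in>carrier_vec n. \<forall>w\<in>carrier_vec n. f (u + v) w = f u w + f v w) \<and>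
     (\<forall>c. \<forall>v\<in>carrier_vec n. \<forall>w\<in>carrier_vec n. f (c \<cdot>\<^sub>v v) w = c * f v w) \<and>
     (\<forall>v\<in>carrier_vec n. \<forall>w\<in>carrier_vec n. f w v = f v w ^ q)"

definition nondegenerate_form :: "nat \<Rightarrow> ('a::field vec \<Rightarrow> 'a vec \<Rightarrow> 'a) \<Rightarrow> bool" where
  "nondegenerate_form n f \<longleftrightarrow>
     (\<forall>v\<in>carrier_vec n. (\<forall>w\<in>carrier_vec n. f v w = 0) \<longrightarrow> v = 0\<^sub>v n)"

definition unitary_group :: "nat \<Rightarrow> ('a::field vec \<Rightarrow> 'a vec \<Rightarrow> 'a) \<Rightarrow> 'a mat monoid" where
  "unitary_group n f =
     \<lparr>carrier = {g \<in> carrier_mat n n. invertible_mat g \<and>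
        (\<forall>v\<in>carrier_vec n. \<forall>w\<in>carrier_vec n. f (g *\<^sub>v v) (g *\<^sub>v w) = f v w)},
      monoid.mult = (*), one = 1\<^sub>m n\<rparr>"

definition conjugacy_classes :: "('g, 'b) monoid_scheme \<Rightarrow> 'g set set" where
  "conjugacy_classes G =
     {{h \<otimes>\<^bsub>G\<^esub> g \<otimes>\<^bsub>G\<^esub> inv\<^bsub>G\<^esub> h | h. h \<in> carrier G} | g. g \<in> carrier G}"

definition centralizer :: "('g, 'b) monoid_scheme \<Rightarrow> 'g \<Rightarrow> 'g set" where
  "centralizer G g = {h \<in> carrier G. h \<otimes>\<^bsub>G\<^esub> g = g \<otimes>\<^bsub>G\<^esub> h}"

definition commutator_space :: "nat \<Rightarrow> 'a::field mat \<Rightarrow> 'a vec set" where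
  "commutator_space n g = (\<lambda>v. (1\<^sub>m n - g) *\<^sub>v v) ` carrier_vec n"

definition coinvariants :: "nat \<Rightarrow> 'a::field mat \<Rightarrow> 'a vec set set" where
  "coinvariants n g = a_rcosets\<^bsub>module_vec TYPE('a) n\<^esub> (commutator_space n g)"

text \<open>A matrix \<open>h\<close> commuting with \<open>g\<close> maps cosets of \<open>[g,V]\<close> to cosets of \<open>[g,V]\<close>.\<close>

definition centralizer_orbits ::
    "nat \<Rightarrow> ('a::field vec \<Rightarrow> 'a vec \<Rightarrow> 'a) \<Rightarrow> 'a mat \<Rightarrow> 'a vec set set set" where
  "centralizer_orbits n f g =
     orbits ((unitary_group n f)\<lparr>carrier := centralizer (unitary_group n f) g\<rparr>)
       (coinvariants n g)
       (\<lambda>h. \<lambda>X\<in>coinvariants n g. (\<lambda>v. h *\<^sub>v v) ` X)"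

text \<open>
  Over a field that does not contain all eigenvalues of \<open>A\<close> there need not be a full Jordan normal
  form, but the generalised eigenspace of an eigenvalue \<open>a\<close> in the field always splits off and has
  a Jordan basis. The list \<open>ks\<close> contains the sizes of the blocks for \<open>a\<close>; the remaining block \<open>B\<close>
  (possibly of size \<open>0\<close>) does not have the eigenvalue \<open>a\<close>. Every square matrix admits such a
  decomposition and \<open>mset ks\<close> is determined by \<open>A\<close> and \<open>a\<close>.
\<close>

definition jordan_blocks_at :: "'a::field mat \<Rightarrow> 'a \<Rightarrow> nat list \<Rightarrow> bool" where
  "jordan_blocks_at A a ks \<longleftrightarrow> 0 \<notin> set ks \<and>
     (\<exists>m. \<exists>B\<in>carrier_mat m m. \<not> eigenvalue B a \<and>
        similar_mat A (diag_block_mat (map (\<lambda>k. jordan_block k a) ks @ [B])))"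

definition jordan_partition :: "'a::field mat \<Rightarrow> 'a \<Rightarrow> nat multiset" where
  "jordan_partition A a = (SOME \<mu>. \<exists>ks. \<mu> = mset ks \<and> jordan_blocks_at A a ks)"

definition distinct_parts :: "nat multiset \<Rightarrow> nat" where
  "distinct_parts \<mu> = card (set_mset \<mu>)"

definition simple_parts :: "nat multiset \<Rightarrow> nat" where
  "simple_parts \<mu> = card {k \<in> set_mset \<mu>. count \<mu> k = 1}"

end

theory Submission
  imports
    Defs
    "Jordan_Normal_Form.Jordan_Normal_Form_Existence"
    "HOL-Number_Theory.Residues"
    "HOL-Library.Product_Plus"
begin

hide_const (open) UnivPoly.coeff UnivPoly.monom

text \<open>
  Put \<open>N = 1 - g\<close> and \<open>K i = ker (N^i)\<close>. Every coset of \<open>N V\<close> has a representative \<open>u\<close> in some \<open>K i\<close>;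
  take \<open>i\<close> minimal. On \<open>K i\<close> the form \<open>B (u, v) = f (u, N^(i-1) v)\<close> is hermitian up to sign, its radical
  is \<open>K i \<inter> (K (i-1) + N V)\<close>, and the quotient by the radical has dimension the number \<open>m\<close> of Jordan
  blocks of size \<open>i\<close>. The pair of \<open>i\<close> and \<open>B (u, u)\<close> depends only on the orbit of the coset.
  Conversely let \<open>u, w\<close> have the same \<open>i\<close> and the same value \<open>B (u, u) = B (w, w)\<close>. After changing
  \<open>w\<close> modulo \<open>N V\<close>, also \<open>f (u, N^j u) = f (w, N^j w)\<close> for all \<open>j\<close>. If \<open>B (u, u - w) \<noteq> 0\<close>, then \<open>V\<close> is
  the direct sum of the cyclic subspace of \<open>u\<close> and the orthogonal complement of the cyclic subspace of
  \<open>u - w\<close>, and the map sending \<open>p(N) u\<close> to \<open>p(N) w\<close> and fixing that complement is an isometry commuting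
  with \<open>g\<close>. Otherwise one first multiplies \<open>w\<close> by a scalar of norm one, or passes through a third,
  isotropic vector. Finally, the values of \<open>B (u, u)\<close> range over a set of \<open>q\<close> elements, from which
  \<open>0\<close> has to be omitted exactly if \<open>m = 1\<close>.
\<close>

section \<open>Finite fields of square order\<close>

text \<open>The obstacle is that \<open>N\<close> is not skew for \<open>f\<close>. The isometry
  condition gives \<open>f (N x, y) = - f (x, N y) + f (N x, N y)\<close>, so moving
  \<open>N\<close> across the form costs a sign and an error term with one more factor
  \<open>N\<close>. On \<open>K i\<close> the error terms die in total degree \<open>i\<close> and
  above. Hence everything is controlled by the total degree \<open>a + b\<close> of
  \<open>f (N^a u, N^b v)\<close> and is proved from the top degree down; the top degree
  \<open>i - 1\<close> yields \<open>B\<close> and its sign \<open>(-1)^(i-1)\<close>. The values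
  \<open>B (u, u)\<close> satisfy \<open>x^q = (-1)^(i-1) * x\<close>, an equation with exactly
  \<open>q\<close> solutions. A nondegenerate hermitian form over a finite field is anisotropic in
  dimension one and isotropic in larger dimension, whence the loss of \<open>0\<close> for
  \<open>m = 1\<close>. The coset \<open>N V\<close> itself gives the summand 1. Trace equations are
  solved by counting and not by halving, so characteristic two is no exception. Dimensions are
  likewise read off from cardinalities.\<close>

lemma card_le_card_image_fibres:
  assumes "finite A" and "\<And>y. y \<in> h ` A \<Longrightarrow> card {x \<in> A. h x = y} \<le> k"
  shows "card A \<le> k * card (h ` A)"
proof -
  have "card A = card (\<Union>y\<in>h ` A. {x \<in> A. h x = y})"
    by (rule arg_cong[of _ _ card]) auto
  also have "\<dots> \<le> (\<Sum>y\<in>h ` A. card {x \<in> A. h x = y})"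
    using assms(1) by (intro card_UN_le) auto
  also have "\<dots> \<le> (\<Sum>y\<in>h ` A. k)"
    by (intro sum_mono assms(2))
  finally show ?thesis by (simp add: mult.commute)
qed

lemma card_roots_le:
  fixes p :: "'a::idom poly"
  assumes "coeff p n \<noteq> 0" and "degree p \<le> n" and "\<And>x. x \<in> A \<Longrightarrow> poly p x = 0"
  shows "card A \<le> n"
proof -
  have "p \<noteq> 0" using assms(1) by auto
  then have "card A \<le> card {x. poly p x = 0}"
    using assms(3) by (intro card_mono poly_roots_finite) auto
  also have "\<dots> \<le> degree p"
    using \<open>p \<noteq> 0\<close> by (rule card_poly_roots_bound)
  finally show ?thesis using assms(2) by simp
qed

text \<open>Multiplication by a nonzero \<open>x\<close> permutes the nonzero elements, so it leaves
  their product unchanged.\<close>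

lemma finite_field_power_card:
  fixes x :: "'a::{field,finite}"
  shows "x ^ card (UNIV :: 'a set) = x"
proof (cases "x = 0")
  case False
  let ?U = "UNIV - {0 :: 'a}"
  have "(\<Prod>y\<in>?U. y) = (\<Prod>y\<in>?U. x * y)"
    using False
    by (intro prod.reindex_bij_witness[of _ "\<lambda>y. x * y" "\<lambda>y. y / x"]) auto
  also have "\<dots> = x ^ card ?U * (\<Prod>y\<in>?U. y)"
    by (simp add: prod.distrib)
  finally have "x ^ card ?U = 1" by simp
  moreover have "card (UNIV :: 'a set) = Suc (card ?U)"
    by (metis card.remove finite iso_tuple_UNIV_I)
  ultimately show ?thesis by (metis mult.right_neutral power_Suc)
qed (simp add: finite_UNIV_card_ge_0)

locale quadratic_field =
  fixes q :: nat and field_type :: "'a::{field,finite} itself"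
  assumes primepow_q: "primepow q" and card_field: "card (UNIV :: 'a set) = q ^ 2"
begin


lemma q_gt_1: "q > 1"
  using primepow_gt_Suc_0[OF primepow_q] by simp

lemma frob_add: "(x + y :: 'a) ^ q = x ^ q + y ^ q"
proof -
  obtain p k where p: "prime p" and q: "q = p ^ k"
    using primepow_q by (auto simp: primepow_def)
  have pr: "prime CHAR('a)"
    by (intro prime_CHAR_semidom finite_imp_CHAR_pos) simp
  have "CHAR('a) dvd (p ^ k) ^ 2"
    using CHAR_dvd_CARD[where 'a='a] card_field q by simp
  then have "CHAR('a) dvd p"
    using pr by (meson prime_dvd_power)
  then have "CHAR('a) = p"
    using p pr by (simp add: primes_dvd_imp_eq)
  then show ?thesis
    using freshmans_dream'[OF pr, of q k] q by simp
qed

lemma frob_zero [simp]: "(0 :: 'a) ^ q = 0"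
  using q_gt_1 by simp

lemma frob_frob [simp]: "((x :: 'a) ^ q) ^ q = x"
  using finite_field_power_card[of x] card_field
  by (simp add: power_mult[symmetric] power2_eq_square)

lemma frob_uminus: "(- x :: 'a) ^ q = - (x ^ q)"
  using frob_add[of x "- x"] by (simp add: eq_neg_iff_add_eq_0 add.commute)

lemma frob_diff: "(x - y :: 'a) ^ q = x ^ q - y ^ q"
  using frob_add[of x "- y"] by (simp add: frob_uminus)

lemma frob_sign: "((-1 :: 'a) ^ k) ^ q = (-1) ^ k"
  by (induction k) (simp_all add: frob_uminus)

text \<open>Two counts meet: the fibres of the map are root sets of polynomials of degree
  \<open>q\<close>, so its image has at least \<open>q^2 / q\<close> elements, while
  \<open>X^q - e X\<close> has at most \<open>q\<close> roots. The signs \<open>e = (-1)^k\<close>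
  are the intended values.\<close>

lemma range_trace:
  fixes e :: 'a
  assumes "e * e = 1" "e ^ q = e"
  shows "range (\<lambda>t. t + e * t ^ q) = {x. x ^ q = e * x} \<and> card {x. x ^ q = e * x} = q"
proof -
  have e0: "e \<noteq> 0" using assms by auto
  let ?I = "range (\<lambda>t. t + e * t ^ q)" and ?E = "{x. x ^ q = e * x}"
  have sub: "?I \<subseteq> ?E"
  proof safe
    fix t
    have "(t + e * t ^ q) ^ q = t ^ q + e * t"
      by (simp add: frob_add power_mult_distrib assms)
    also have "\<dots> = e * e * t ^ q + e * t"
      by (simp add: assms)
    finally show "(t + e * t ^ q) ^ q = e * (t + e * t ^ q)"
      by (simp add: algebra_simps)
  qed
  have "card {t \<in> UNIV. t + e * t ^ q = y} \<le> q" for y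
    by (rule card_roots_le[of "monom e q + [:- y, 1:]"])
      (use e0 q_gt_1 in \<open>auto simp: poly_monom degree_add_le degree_monom_le
          coeff_pCons split: nat.split\<close>)
  then have "card (UNIV :: 'a set) \<le> q * card ?I"
    by (intro card_le_card_image_fibres) auto
  then have "q \<le> card ?I"
    using card_field q_gt_1 by (simp add: power2_eq_square)
  moreover have "card ?E \<le> q"
    by (rule card_roots_le[of "monom 1 q - [:0, e:]"])
      (use q_gt_1 in \<open>auto simp: poly_monom degree_diff_le degree_monom_le
          coeff_pCons mult.commute split: nat.split\<close>)
  ultimately show ?thesis
    using sub card_seteq[OF _ sub] card_mono[OF _ sub] by auto
qed

lemma trace_surj:
  fixes e x :: 'a
  assumes "e * e = 1" "e ^ q = e" "x ^ q = e * x"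
  obtains t where "t + e * t ^ q = x"
proof -
  have "x \<in> range (\<lambda>t. t + e * t ^ q)"
    using range_trace[OF assms(1,2)] assms(3) by simp
  then show ?thesis using that by auto
qed

lemma card_frob_eigenspace:
  fixes e :: 'a
  assumes "e * e = 1" "e ^ q = e"
  shows "card {x. x ^ q = e * x} = q"
  using range_trace[OF assms] by blast

text \<open>Fibres of the norm have at most \<open>q + 1\<close> elements, so its image has at least
  \<open>(q^2 - 1) / (q + 1) = q - 1\<close> elements, which is the number of nonzero elements of
  the subfield.\<close>

lemma norm_surj:
  fixes x :: 'a
  assumes "x ^ q = x" "x \<noteq> 0"
  obtains t where "t \<noteq> 0" "t * t ^ q = x"
proof -
  let ?U = "UNIV - {0 :: 'a}" and ?F = "{x :: 'a. x ^ q = x} - {0}"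
  let ?I = "(\<lambda>t. t * t ^ q) ` ?U"
  have cU: "card ?U = (q - 1) * (q + 1)"
    by (simp add: card_Diff_singleton card_field power2_eq_square algebra_simps)
  have sub: "?I \<subseteq> ?F"
    using q_gt_1 by (auto simp: power_mult_distrib mult.commute)
  have "card {t \<in> ?U. t * t ^ q = y} \<le> q + 1" for y
    by (rule card_roots_le[of "monom 1 (q + 1) - [:y:]"])
      (use q_gt_1 in \<open>auto simp: poly_monom degree_diff_le degree_monom_le
          coeff_pCons split: nat.split\<close>)
  then have "card ?U \<le> (q + 1) * card ?I"
    by (intro card_le_card_image_fibres) auto
  then have "q - 1 \<le> card ?I"
    unfolding cU by (simp add: mult.commute del: mult_Suc mult_Suc_right)
  moreover have "card ?F = q - 1"
    using card_frob_eigenspace[of 1] q_gt_1 by (simp add: card_Diff_singleton)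
  ultimately have "?I = ?F"
    using sub by (intro card_seteq) auto
  then have "x \<in> ?I" using assms by auto
  then show ?thesis using that by auto
qed

text \<open>As in Hilbert 90: \<open>x^q / x\<close> has norm one, and it differs from 1 once
  \<open>x\<close> lies outside the subfield.\<close>

lemma ex_norm_one:
  obtains z :: 'a where "z * z ^ q = 1" "z \<noteq> 1"
proof -
  have "card {x :: 'a. x ^ q = x} \<noteq> card (UNIV :: 'a set)"
    using card_frob_eigenspace[of 1] card_field q_gt_1 by (simp add: power2_eq_square)
  then obtain x :: 'a where x: "x ^ q \<noteq> x" by force
  then have "x \<noteq> 0" "x ^ q \<noteq> 0" by auto
  with x show ?thesis
    by (intro that[of "x ^ q / x"]) (auto simp: power_divide)
qed

end

section \<open>Hermitian spaces with an isometry\<close>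

text \<open>The homomorphism theorem as a count; it takes the place of the rank-nullity
  formula.\<close>

lemma card_eq_card_image_kernel:
  fixes h :: "'b::ab_group_add \<Rightarrow> 'c::ab_group_add"
  assumes "finite A" and diff: "\<And>x y. x \<in> A \<Longrightarrow> y \<in> A \<Longrightarrow> x - y \<in> A"
    and h_diff: "\<And>x y. x \<in> A \<Longrightarrow> y \<in> A \<Longrightarrow> h (x - y) = h x - h y"
  shows "card A = card (h ` A) * card {x \<in> A. h x = 0}"
proof -
  have fib: "card {x \<in> A. h x = h z} = card {x \<in> A. h x = 0}" if z: "z \<in> A" for z
  proof -
    have minus: "x \<in> A \<Longrightarrow> - x \<in> A" for x
      using diff[of z z] diff[of "z - z" x] z by simp
    have "h x + h z = h (x + z)" if "x \<in> A" for x
      using h_diff[of "x + z" z] diff[of x "- z"] minus z that by simp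
    moreover have "x + z \<in> A" if "x \<in> A" for x
      using diff[of x "- z"] minus z that by simp
    ultimately have "bij_betw (\<lambda>x. x - z) {x \<in> A. h x = h z} {x \<in> A. h x = 0}"
      using z diff h_diff
      by (intro bij_betwI[where g = "\<lambda>x. x + z"]) (auto simp flip: \<open>\<And>x. x \<in> A \<Longrightarrow> _ = _\<close>)
    then show ?thesis by (rule bij_betw_same_card)
  qed
  have "card A = card (\<Union>y\<in>h ` A. {x \<in> A. h x = y})"
    by (rule arg_cong[of _ _ card]) auto
  also have "\<dots> = (\<Sum>y\<in>h ` A. card {x \<in> A. h x = y})"
    using assms(1) by (intro card_UN_disjoint) auto
  also have "\<dots> = (\<Sum>y\<in>h ` A. card {x \<in> A. h x = 0})"
    using fib by (intro sum.cong) auto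
  finally show ?thesis by simp
qed

text \<open>
  \<open>N\<close> stands for \<open>1 - g\<close> with an isometry \<open>g\<close>. The maps \<open>f\<close> and \<open>N\<close> satisfy their algebraic laws on
  the whole ambient type, so that membership in \<open>V\<close> matters only for nondegeneracy and finiteness.
\<close>

locale hermitian_space = vector_space scale + quadratic_field q "TYPE('a)"
  for scale :: "'a::{field,finite} \<Rightarrow> 'b::ab_group_add \<Rightarrow> 'b" (infixr \<open>*s\<close> 75) and q :: nat +
  fixes V :: "'b set" and f :: "'b \<Rightarrow> 'b \<Rightarrow> 'a" and N :: "'b \<Rightarrow> 'b"
  assumes V: "subspace V" and finite_V: "finite V"
    and f_add: "f (x + y) z = f x z + f y z"
    and f_scale: "f (c *s x) y = c * f x y"
    and f_herm: "f y x = f x y ^ q"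
    and nondegenerate: "x \<in> V \<Longrightarrow> (\<And>y. y \<in> V \<Longrightarrow> f x y = 0) \<Longrightarrow> x = 0"
    and N_add: "N (x + y) = N x + N y"
    and N_scale: "N (c *s x) = c *s N x"
    and N_V: "x \<in> V \<Longrightarrow> N x \<in> V"
    and isometry: "f (x - N x) (y - N y) = f x y"
begin

section \<open>Calculus of the form and of \<open>N\<close>\<close>

lemma f_add_right: "f x (y + z) = f x y + f x z"
  by (subst (1 2 3) f_herm) (simp add: f_add frob_add)

lemma f_scale_right: "f x (c *s y) = c ^ q * f x y"
  by (subst (1 2) f_herm) (simp add: f_scale power_mult_distrib)

lemma f_zero [simp]: "f 0 x = 0" "f x 0 = 0"
  using f_scale[of 0 0 x] f_scale_right[of x 0 0] by simp_all

lemma f_uminus: "f (- x) y = - f x y" "f x (- y) = - f x y"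
  using f_add[of x "- x" y] f_add_right[of x y "- y"]
  by (simp_all add: eq_neg_iff_add_eq_0 add.commute)

lemma f_diff: "f (x - y) z = f x z - f y z" "f x (y - z) = f x y - f x z"
  using f_add[of x "- y" z] f_add_right[of x y "- z"] by (simp_all add: f_uminus)

lemmas f_simps = f_add f_add_right f_scale f_scale_right f_diff f_uminus

lemma f_eq_0_sym: "f x y = 0 \<longleftrightarrow> f y x = 0"
  using f_herm[of x y] f_herm[of y x] frob_zero by metis

lemma N_zero [simp]: "N 0 = 0"
  using N_scale[of 0 0] by simp

lemma N_uminus: "N (- x) = - N x"
  using N_add[of x "- x"] by (simp add: eq_neg_iff_add_eq_0 add.commute)

lemma N_diff: "N (x - y) = N x - N y"
  using N_add[of x "- y"] by (simp add: N_uminus)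

lemma Npow_add: "(N ^^ k) (x + y) = (N ^^ k) x + (N ^^ k) y"
  by (induction k) (simp_all add: N_add)

lemma Npow_scale: "(N ^^ k) (c *s x) = c *s (N ^^ k) x"
  by (induction k) (simp_all add: N_scale)

lemma Npow_zero [simp]: "(N ^^ k) 0 = 0"
  by (induction k) simp_all

lemma Npow_uminus: "(N ^^ k) (- x) = - (N ^^ k) x"
  by (induction k) (simp_all add: N_uminus)

lemma Npow_diff: "(N ^^ k) (x - y) = (N ^^ k) x - (N ^^ k) y"
  by (induction k) (simp_all add: N_diff)

lemmas Npow_simps = Npow_add Npow_scale Npow_uminus Npow_diff

lemma Npow_V: "x \<in> V \<Longrightarrow> (N ^^ k) x \<in> V"
  by (induction k) (simp_all add: N_V)

lemma Npow_Npow: "(N ^^ j) ((N ^^ k) x) = (N ^^ (j + k)) x"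
  by (simp add: funpow_add)

lemma Npow_N: "(N ^^ k) (N x) = N ((N ^^ k) x)"
  by (simp add: funpow_swap1)

text \<open>The exchange rule behind all inductions on the degree: the second term is the expected
  sign change, the first one has a factor \<open>N\<close> more.\<close>

lemma f_N: "f (N x) y = f (N x) (N y) - f x (N y)"
  using isometry[of x y] by (simp add: f_diff algebra_simps)

lemma f_N_right: "f x (N y) = f (N x) (N y) - f (N x) y"
  using f_N[of x y] by simp

lemmas V_closed = subspace_0[OF V] subspace_add[OF V] subspace_diff[OF V] subspace_scale[OF V]
  subspace_neg[OF V]

text \<open>The map is \<open>g = 1 - N\<close>. Nondegeneracy makes it injective on the finite set
  \<open>V\<close>, hence surjective.\<close>

lemma g_surj:
  assumes "y \<in> V"
  obtains x where "x \<in> V" "x - N x = y"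
proof -
  have "inj_on (\<lambda>x. x - N x) V"
  proof (rule inj_onI)
    fix x y assume xy: "x \<in> V" "y \<in> V" "x - N x = y - N y"
    then have "(x - y) - N (x - y) = 0"
      by (simp add: N_diff algebra_simps)
    then have "f (x - y) z = 0" for z
      using isometry[of "x - y" z] by simp
    then show "x = y"
      using nondegenerate[of "x - y"] xy by (simp add: V_closed)
  qed
  then have "(\<lambda>x. x - N x) ` V = V"
    using finite_V by (intro endo_inj_surj) (auto simp: V_closed N_V)
  then have "y \<in> (\<lambda>x. x - N x) ` V" using assms by simp
  then show ?thesis using that by auto
qed

section \<open>Kernels of powers of \<open>N\<close> and orthogonality\<close>

definition K :: "nat \<Rightarrow> 'b set" where
  "K i = {x \<in> V. (N ^^ i) x = 0}"

lemma K_V: "x \<in> K i \<Longrightarrow> x \<in> V" by (simp add: K_def)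

lemma K_Npow: "x \<in> K i \<Longrightarrow> i \<le> j \<Longrightarrow> (N ^^ j) x = 0"
  using Npow_Npow[of "j - i" i x] by (simp add: K_def)

lemma K_mono: "i \<le> j \<Longrightarrow> K i \<subseteq> K j"
  using K_Npow by (auto simp: K_def)

lemma subspace_K: "subspace (K i)"
  by (rule subspaceI) (auto simp: K_def V_closed Npow_simps)

lemma K_closed: "0 \<in> K i" "x \<in> K i \<Longrightarrow> y \<in> K i \<Longrightarrow> x + y \<in> K i"
  "x \<in> K i \<Longrightarrow> y \<in> K i \<Longrightarrow> x - y \<in> K i" "x \<in> K i \<Longrightarrow> c *s x \<in> K i"
  "x \<in> K i \<Longrightarrow> - x \<in> K i"
  using subspace_K by (auto simp: subspace_0 subspace_add subspace_diff subspace_scale subspace_neg)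

lemma finite_K [simp]: "finite (K i)"
  using finite_V by (simp add: K_def)

lemma K_0: "K 0 = {0}"
  using V_closed by (auto simp: K_def)

lemma N_K: "x \<in> K i \<Longrightarrow> N x \<in> K i"
  using K_Npow[of x i "Suc i"] by (simp add: K_def N_V Npow_N)

lemma N_K_Suc: "x \<in> K (Suc i) \<Longrightarrow> N x \<in> K i"
  by (simp add: K_def N_V Npow_N)

lemma Npow_K: "x \<in> K i \<Longrightarrow> (N ^^ k) x \<in> K (i - k)"
  using K_Npow[of x i "i - k + k"] by (simp add: K_V Npow_V Npow_Npow K_def[of "i - k"])

text \<open>By \<open>f_N\<close> one factor moves to the right; the error term keeps the left
  exponent but has a larger right one, hence the inner induction on \<open>i - j\<close>, which
  starts where \<open>N^j y\<close> vanishes.\<close>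

lemma f_Npow_eq_0:
  assumes "x \<in> K i" "y \<in> K i" "i \<le> m + j"
  shows "f ((N ^^ m) x) ((N ^^ j) y) = 0"
  using assms(3)
proof (induction m arbitrary: j)
  case 0
  then show ?case using K_Npow[OF assms(2)] by simp
next
  case (Suc m)
  show ?case
    using Suc.prems
  proof (induction "i - j" arbitrary: j)
    case 0
    then show ?case using K_Npow[OF assms(2)] by simp
  next
    case (Suc d)
    have "f ((N ^^ Suc m) x) ((N ^^ Suc j) y) = 0"
      using Suc.hyps(2) Suc.prems by (intro Suc.hyps(1)) auto
    moreover have "f ((N ^^ m) x) ((N ^^ Suc j) y) = 0"
      using Suc.prems by (intro Suc.IH) auto
    ultimately show ?case
      using f_N[of "(N ^^ m) x" "(N ^^ j) y"] by simp
  qed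
qed

text \<open>In total degree \<open>i - 1\<close> the error term of \<open>f_N\<close> has degree
  \<open>i\<close> and vanishes, so each exchange costs exactly a sign.\<close>

lemma f_Npow_top:
  assumes "x \<in> K i" "y \<in> K i" "m + j = i - 1" "i > 0"
  shows "f ((N ^^ m) x) ((N ^^ j) y) = (-1) ^ m * f x ((N ^^ (i - 1)) y)"
  using assms(3)
proof (induction m arbitrary: j)
  case (Suc m)
  have "f ((N ^^ Suc m) x) ((N ^^ Suc j) y) = 0"
    using Suc.prems by (intro f_Npow_eq_0[OF assms(1,2)]) auto
  then show ?case
    using Suc.IH[of "Suc j"] Suc.prems f_N[of "(N ^^ m) x" "(N ^^ j) y"] by simp
qed auto

text \<open>This is the double annihilator theorem for \<open>X\<close>. It is proved without
  dimensions: a maximal subspace \<open>Y\<close> of \<open>X\<close> for which separation holds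
  must be \<open>X\<close>, because separation survives adding one more vector \<open>x\<close>.
  Nondegeneracy is the case \<open>Y = {0}\<close>.\<close>

lemma separating_vector:
  assumes X: "subspace X" "X \<subseteq> V" and u: "u \<in> V" "u \<notin> X"
  obtains y where "y \<in> V" "\<And>x. x \<in> X \<Longrightarrow> f x y = 0" "f u y \<noteq> 0"
proof -
  define P where "P Y \<longleftrightarrow> subspace Y \<and> Y \<subseteq> X \<and>
    (\<forall>u\<in>V - Y. \<exists>y\<in>V. (\<forall>x\<in>Y. f x y = 0) \<and> f u y \<noteq> 0)" for Y
  have "P {0}"
    using nondegenerate X subspace_0[OF X(1)] by (fastforce simp: P_def)
  moreover have "finite {Y. P Y}"
    by (rule finite_subset[of _ "Pow X"]) (use X finite_V in \<open>auto simp: P_def finite_subset\<close>)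
  ultimately obtain Y where Y: "P Y" and max: "\<And>Z. P Z \<Longrightarrow> Y \<subseteq> Z \<Longrightarrow> Z = Y"
    using finite_has_maximal2[of "{Y. P Y}" "{0}"] by auto
  have Ysub: "subspace Y" and YX: "Y \<subseteq> X"
    and Ysep: "\<And>u. u \<in> V \<Longrightarrow> u \<notin> Y \<Longrightarrow> \<exists>y\<in>V. (\<forall>x\<in>Y. f x y = 0) \<and> f u y \<noteq> 0"
    using Y by (auto simp: P_def)
  have "x \<in> Y" if "x \<in> X" for x
  proof (rule ccontr)
    assume "x \<notin> Y"
    then obtain y1 where y1: "y1 \<in> V" "\<And>x. x \<in> Y \<Longrightarrow> f x y1 = 0" "f x y1 \<noteq> 0"
      using Ysep[of x] \<open>x \<in> X\<close> X by auto
    define Z where "Z = {y + c *s x | y c. y \<in> Y}"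
    have "subspace Z"
    proof (rule subspaceI)
      have "0 = 0 + 0 *s x" by simp
      then show "0 \<in> Z" unfolding Z_def using subspace_0[OF Ysub] by blast
    next
      fix a b assume "a \<in> Z" "b \<in> Z"
      then obtain y c y' c' where "a = y + c *s x" "b = y' + c' *s x" "y \<in> Y" "y' \<in> Y"
        by (auto simp: Z_def)
      then have "a + b = (y + y') + (c + c') *s x" "y + y' \<in> Y"
        using subspace_add[OF Ysub] by (auto simp: algebra_simps)
      then show "a + b \<in> Z" unfolding Z_def by blast
    next
      fix k a assume "a \<in> Z"
      then obtain y c where "a = y + c *s x" "y \<in> Y" by (auto simp: Z_def)
      then have "k *s a = k *s y + (k * c) *s x" "k *s y \<in> Y"
        using subspace_scale[OF Ysub] by (auto simp: algebra_simps)
      then show "k *s a \<in> Z" unfolding Z_def by blast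
    qed
    moreover have "Z \<subseteq> X"
      using YX \<open>x \<in> X\<close> X(1) by (auto simp: Z_def intro!: subspace_add subspace_scale)
    moreover have "\<exists>y\<in>V. (\<forall>x\<in>Z. f x y = 0) \<and> f u y \<noteq> 0" if u: "u \<in> V" "u \<notin> Z" for u
    proof -
      \<comment> \<open>Subtracting \<open>d *s x\<close> makes \<open>u'\<close> orthogonal to
        \<open>y1\<close>, so correcting \<open>y2\<close> by a multiple of \<open>y1\<close> cannot
        disturb the pairing with \<open>u'\<close>.\<close>
      define d where "d = f u y1 / f x y1"
      define u' where "u' = u - d *s x"
      have "u = u' + d *s x" by (simp add: u'_def)
      then have "u' \<notin> Y" using u by (auto simp: Z_def)
      moreover have "u' \<in> V" using u \<open>x \<in> X\<close> X by (auto simp: u'_def V_closed)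
      ultimately obtain y2 where y2: "y2 \<in> V" "\<And>x. x \<in> Y \<Longrightarrow> f x y2 = 0" "f u' y2 \<noteq> 0"
        using Ysep by blast
      \<comment> \<open>The coefficient is chosen to give \<open>f x y = 0\<close>; the power
        \<open>q\<close> undoes the conjugation in the second argument.\<close>
      define y where "y = y2 - (f x y2 / f x y1) ^ q *s y1"
      have "f x y = 0" using y1 by (simp add: y_def f_simps)
      moreover have "f u' y1 = 0" using y1 by (simp add: u'_def d_def f_simps)
      then have "f u' y \<noteq> 0" using y2 by (simp add: y_def f_simps)
      then have "f u y \<noteq> 0"
        using \<open>f x y = 0\<close> \<open>u = u' + d *s x\<close> by (simp add: f_simps)
      moreover have "f z y = 0" if "z \<in> Y" for z
        using that y1 y2 by (simp add: y_def f_simps)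
      moreover have "y \<in> V" using y1 y2 by (simp add: y_def V_closed)
      ultimately show ?thesis
        by (intro bexI[of _ y]) (auto simp: Z_def f_simps)
    qed
    ultimately have "P Z" by (auto simp: P_def)
    moreover have "Y \<subseteq> Z"
    proof
      fix y assume "y \<in> Y"
      then have "y + 0 *s x \<in> Z" unfolding Z_def by blast
      then show "y \<in> Z" by simp
    qed
    ultimately have "Z = Y" by (rule max)
    moreover have "0 + 1 *s x \<in> Z" unfolding Z_def using subspace_0[OF Ysub] by blast
    ultimately show False using \<open>x \<notin> Y\<close> by simp
  qed
  with YX have "Y = X" by blast
  then show ?thesis using Ysep[OF u(1)] u(2) that by auto
qed

text \<open>With \<open>f_K_Npow\<close> this identifies the orthogonal complement of
  \<open>N^m V\<close> with \<open>K m\<close>.\<close>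

lemma perp_image_Npow:
  assumes "t \<in> V" "\<And>x. x \<in> V \<Longrightarrow> f ((N ^^ m) x) t = 0"
  shows "(N ^^ m) t = 0"
  using assms
proof (induction m arbitrary: t)
  case 0
  have "f t x = 0" if "x \<in> V" for x
    using 0(2)[OF that] f_eq_0_sym by auto
  then show ?case using nondegenerate 0 by auto
next
  case (Suc m)
  have "f ((N ^^ m) x) (N t) = 0" if "x \<in> V" for x
  proof -
    \<comment> \<open>Writing \<open>x = g x'\<close> allows \<open>g\<close> to be cancelled on
      both sides of the form, since \<open>t - N t = g t\<close> and \<open>g\<close> commutes with
      \<open>N\<close>.\<close>
    obtain x' where x': "x' \<in> V" "x = x' - N x'" using g_surj[OF \<open>x \<in> V\<close>] by metis
    let ?z = "N ((N ^^ m) x')"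
    have "N ((N ^^ m) x) = ?z - N ?z"
      using x' by (simp add: Npow_diff N_diff Npow_N)
    then have "f (N ((N ^^ m) x)) (t - N t) = f ?z t"
      by (simp only: isometry)
    also have "\<dots> = 0" using Suc.prems(2)[OF x'(1)] by simp
    finally show ?thesis
      using f_N_right[of "(N ^^ m) x" t] by (simp add: f_diff)
  qed
  then have "(N ^^ m) (N t) = 0"
    using Suc.prems(1) by (intro Suc.IH N_V)
  then show ?case by (simp add: Npow_N)
qed

lemma f_K_Npow: "x \<in> K m \<Longrightarrow> f x ((N ^^ m) y) = 0"
proof (induction m arbitrary: x y)
  case 0
  then show ?case by (simp add: K_0)
next
  case (Suc m)
  then have "N x \<in> K m" by (intro N_K_Suc)
  then have "f (N x) ((N ^^ m) (N y)) = 0" "f (N x) ((N ^^ m) y) = 0"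
    using Suc.IH by blast+
  then show ?case
    using f_N_right[of x "(N ^^ m) y"] by (simp add: Npow_N)
qed

lemma f_N_kernel: "N y = 0 \<Longrightarrow> f (N x) y = 0"
  using f_N[of x y] by simp

section \<open>The hermitian form on \<open>K i\<close> and its radical\<close>

text \<open>
  \<open>B i\<close> is meant to be used on \<open>K i\<close> with \<open>i > 0\<close>, where it is hermitian up to the sign
  \<open>(-1) ^ (i - 1)\<close>. The quotient \<open>K i / rad i\<close> is the layer of \<open>V / N V\<close> that belongs to the Jordan
  blocks of size \<open>i\<close>.
\<close>

definition B :: "nat \<Rightarrow> 'b \<Rightarrow> 'b \<Rightarrow> 'a" where
  "B i x y = f x ((N ^^ (i - 1)) y)"

definition rad :: "nat \<Rightarrow> 'b set" where
  "rad i = {u \<in> K i. \<forall>z\<in>K i. B i u z = 0}"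

lemma B_simps: "B i (x + y) z = B i x z + B i y z" "B i x (y + z) = B i x y + B i x z"
  "B i (x - y) z = B i x z - B i y z" "B i x (y - z) = B i x y - B i x z"
  "B i (c *s x) y = c * B i x y" "B i x (c *s y) = c ^ q * B i x y"
  by (simp_all add: B_def f_simps Npow_simps)

lemma B_herm:
  assumes "x \<in> K i" "y \<in> K i" "i > 0"
  shows "B i y x = (-1) ^ (i - 1) * B i x y ^ q"
proof -
  have "B i y x = f ((N ^^ (i - 1)) x) y ^ q"
    unfolding B_def by (rule f_herm)
  also have "f ((N ^^ (i - 1)) x) y = (-1) ^ (i - 1) * B i x y"
    using f_Npow_top[OF assms(1,2), of "i - 1" 0] assms(3) by (simp add: B_def)
  finally show ?thesis by (simp add: power_mult_distrib frob_sign)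
qed

lemma sign_square: "(-1 :: 'a) ^ k * (-1) ^ k = 1"
  by (simp flip: power_mult_distrib)

lemma B_self:
  assumes "x \<in> K i" "i > 0"
  shows "B i x x ^ q = (-1) ^ (i - 1) * B i x x"
proof -
  have "B i x x ^ q = ((-1) ^ (i - 1) * (-1) ^ (i - 1)) * B i x x ^ q"
    by (simp add: sign_square)
  also have "\<dots> = (-1) ^ (i - 1) * B i x x"
    using B_herm[OF assms(1,1,2)] by (simp only: mult.assoc)
  finally show ?thesis .
qed

lemma B_eq_0_sym: "x \<in> K i \<Longrightarrow> y \<in> K i \<Longrightarrow> i > 0 \<Longrightarrow> B i x y = 0 \<longleftrightarrow> B i y x = 0"
  using B_herm[of x i y] B_herm[of y i x] frob_zero by (metis mult_zero_right)

lemma B_N_left: "y \<in> K i \<Longrightarrow> i > 0 \<Longrightarrow> B i (N x) y = 0"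
  unfolding B_def using K_Npow[of y i i] by (intro f_N_kernel) (cases i; simp)

lemma B_N_right: "x \<in> K i \<Longrightarrow> i > 0 \<Longrightarrow> B i x (N y) = 0"
  unfolding B_def using f_K_Npow[of x i y] by (cases i) (simp_all add: Npow_N)

lemma subspace_rad: "subspace (rad i)"
  by (rule subspaceI) (auto simp: rad_def K_closed B_simps B_def[of _ 0])

lemma subspace_K_plus_image: "subspace {a + N z | a z. a \<in> K i \<and> z \<in> V}" (is "subspace ?X")
proof (rule subspaceI)
  have "0 = 0 + N 0" by simp
  then show "0 \<in> ?X" using K_closed(1) V_closed(1) by blast
next
  fix x y assume "x \<in> ?X" "y \<in> ?X"
  then obtain a z b t where "x = a + N z" "y = b + N t" "a \<in> K i" "b \<in> K i" "z \<in> V" "t \<in> V"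
    by auto
  then have "x + y = (a + b) + N (z + t)" "a + b \<in> K i" "z + t \<in> V"
    by (auto simp: N_add K_closed V_closed algebra_simps)
  then show "x + y \<in> ?X" by blast
next
  fix c x assume "x \<in> ?X"
  then obtain a z where "x = a + N z" "a \<in> K i" "z \<in> V" by auto
  then have "c *s x = c *s a + N (c *s z)" "c *s a \<in> K i" "c *s z \<in> V"
    by (auto simp: N_scale K_closed V_closed algebra_simps)
  then show "c *s x \<in> ?X" by blast
qed

text \<open>A vector outside \<open>K (i - 1) + N V\<close> is separated from it by some
  \<open>y\<close>. Orthogonality to \<open>N V\<close> gives \<open>N y = 0\<close>, and
  orthogonality to \<open>K (i - 1)\<close> gives \<open>y = N^(i-1) z\<close>. So \<open>z\<close>
  lies in \<open>K i\<close> and \<open>B i u z\<close> is nonzero. Conversely \<open>B i\<close>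
  vanishes on both summands.\<close>

lemma rad_iff:
  assumes "i > 0"
  shows "u \<in> rad i \<longleftrightarrow> u \<in> K i \<and> (\<exists>z\<in>V. u - N z \<in> K (i - 1))"
proof (intro iffI conjI)
  assume u: "u \<in> rad i"
  then show uK: "u \<in> K i" by (simp add: rad_def)
  let ?X = "{a + N z | a z. a \<in> K (i - 1) \<and> z \<in> V}"
  have "u \<in> ?X"
  proof (rule ccontr)
    assume "u \<notin> ?X"
    have "?X \<subseteq> V" by (auto simp: K_V V_closed N_V)
    obtain y where y: "y \<in> V" "\<And>x. x \<in> ?X \<Longrightarrow> f x y = 0" "f u y \<noteq> 0"
      by (rule separating_vector[OF subspace_K_plus_image \<open>?X \<subseteq> V\<close> K_V[OF uK] \<open>u \<notin> ?X\<close>])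
        (rule that)
    have "f (N z) y = 0" if "z \<in> V" for z
    proof -
      have "0 + N z \<in> ?X" using that K_closed(1) by blast
      then show ?thesis using y by simp
    qed
    then have Ny: "N y = 0" using perp_image_Npow[of y 1] y(1) by simp
    have Ky: "f a y = 0" if "a \<in> K (i - 1)" for a
    proof -
      have "a + N 0 \<in> ?X" using that V_closed(1) by blast
      then show ?thesis using y by simp
    qed
    \<comment> \<open>Otherwise some \<open>t\<close> orthogonal to \<open>N^(i-1) V\<close>, hence
      lying in \<open>K (i - 1)\<close>, would pair nontrivially with \<open>y\<close>.\<close>
    have "y \<in> (N ^^ (i - 1)) ` V"
    proof (rule ccontr)
      assume "y \<notin> (N ^^ (i - 1)) ` V"
      moreover have "subspace ((N ^^ (i - 1)) ` V)"
        by (rule subspaceI)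
          (auto simp: V_closed image_iff simp flip: Npow_simps
            intro: bexI[of _ 0] bexI[of _ "_ + _"] bexI[of _ "_ *s _"])
      ultimately obtain t where t: "t \<in> V" "\<And>x. x \<in> V \<Longrightarrow> f ((N ^^ (i - 1)) x) t = 0" "f y t \<noteq> 0"
        using separating_vector[of "(N ^^ (i - 1)) ` V" y] y(1) Npow_V
        by (metis image_eqI image_subsetI)
      then have "t \<in> K (i - 1)" using perp_image_Npow[of t "i - 1"] by (simp add: K_def)
      then show False using Ky t(3) f_eq_0_sym by blast
    qed
    then obtain z where z: "z \<in> V" "y = (N ^^ (i - 1)) z" by blast
    then have "z \<in> K i" using Ny assms by (cases i) (auto simp: K_def)
    then show False using u y(3) z(2) by (auto simp: rad_def B_def)
  qed
  then obtain a z where "u = a + N z" "a \<in> K (i - 1)" "z \<in> V" by blast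
  then show "\<exists>z\<in>V. u - N z \<in> K (i - 1)" by (intro bexI[of _ z]) auto
next
  assume u: "u \<in> K i \<and> (\<exists>z\<in>V. u - N z \<in> K (i - 1))"
  then obtain z where z: "z \<in> V" "u - N z \<in> K (i - 1)" by blast
  have "B i u y = 0" if "y \<in> K i" for y
  proof -
    have "B i (u - N z) y = 0" unfolding B_def using z(2) by (rule f_K_Npow)
    then show ?thesis using B_N_left[OF that assms] by (simp add: B_simps)
  qed
  with u show "u \<in> rad i" by (simp add: rad_def)
qed

text \<open>The map \<open>(a, z) |-> a + N z\<close> sends
  \<open>K (i - 1) \<times> K (i + 1)\<close> onto \<open>rad i\<close>, and its kernel is a copy of
  \<open>K i\<close>.\<close>

lemma card_rad:
  assumes "i > 0"
  shows "card (rad i) * card (K i) = card (K (i - 1)) * card (K (Suc i))"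
proof -
  let ?A = "K (i - 1) \<times> K (Suc i)" and ?h = "\<lambda>(a, z). a + N z"
  have NK: "N z \<in> K i" if "z \<in> K (Suc i)" for z
    using that by (rule N_K_Suc)
  have img: "?h ` ?A = rad i"
  proof (intro equalityI subsetI)
    fix u assume "u \<in> ?h ` ?A"
    then obtain a z where *: "u = a + N z" "a \<in> K (i - 1)" "z \<in> K (Suc i)" by auto
    moreover have "a \<in> K i" using * K_mono[of "i - 1" i] by auto
    ultimately have "u \<in> K i" "z \<in> V" "u - N z \<in> K (i - 1)"
      using NK K_V by (auto simp: K_closed)
    then show "u \<in> rad i" unfolding rad_iff[OF assms] by blast
  next
    fix u assume "u \<in> rad i"
    then obtain z where z: "u \<in> K i" "z \<in> V" "u - N z \<in> K (i - 1)"
      unfolding rad_iff[OF assms] by blast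
    have "u - N z \<in> K i" using z K_mono[of "i - 1" i] by auto
    then have "N z \<in> K i" using K_closed(3)[OF z(1)] by fastforce
    then have "z \<in> K (Suc i)" using z(2) by (simp add: K_def Npow_N)
    then have "(u - N z, z) \<in> ?A" "u = ?h (u - N z, z)" using z by auto
    then show "u \<in> ?h ` ?A" by blast
  qed
  have ker: "{x \<in> ?A. ?h x = 0} = (\<lambda>z. (- N z, z)) ` K i"
  proof (intro equalityI subsetI)
    fix x assume "x \<in> {x \<in> ?A. ?h x = 0}"
    then obtain a z where *: "x = (a, z)" "a \<in> K (i - 1)" "z \<in> K (Suc i)" "a + N z = 0" by auto
    then have a: "a = - N z" by (simp add: eq_neg_iff_add_eq_0)
    then have "N z \<in> K (i - 1)" using *(2) K_closed(5)[of a] by simp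
    then have "z \<in> K i" using assms *(3) by (cases i) (auto simp: K_def Npow_N)
    then show "x \<in> (\<lambda>z. (- N z, z)) ` K i" using * a by auto
  next
    fix x assume "x \<in> (\<lambda>z. (- N z, z)) ` K i"
    then obtain z where *: "x = (- N z, z)" "z \<in> K i" by auto
    then have "N z \<in> K (i - 1)" using assms by (cases i) (auto intro: N_K_Suc)
    then show "x \<in> {x \<in> ?A. ?h x = 0}" using * K_mono[of i "Suc i"] by (auto simp: K_closed)
  qed
  have "card ?A = card (?h ` ?A) * card {x \<in> ?A. ?h x = 0}"
    by (rule card_eq_card_image_kernel) (auto simp: K_closed N_diff)
  moreover have "card ((\<lambda>z. (- N z, z)) ` K i) = card (K i)"
    by (intro card_image inj_onI) auto
  ultimately show ?thesis unfolding img ker by (simp add: card_cartesian_product)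
qed

section \<open>Extending \<open>u |-> w\<close> to an isometry commuting with
  \<open>N\<close>\<close>

text \<open>These maps model the centralizer of \<open>g\<close> on \<open>V\<close>; their
  injectivity follows from preserving a nondegenerate form.\<close>

definition isometries :: "('b \<Rightarrow> 'b) set" where
  "isometries = {h. (\<forall>x\<in>V. h x \<in> V) \<and> (\<forall>x\<in>V. \<forall>y\<in>V. h (x + y) = h x + h y) \<and>
     (\<forall>c. \<forall>x\<in>V. h (c *s x) = c *s h x) \<and> (\<forall>x\<in>V. \<forall>y\<in>V. f (h x) (h y) = f x y) \<and>
     (\<forall>x\<in>V. h (N x) = N (h x))}"

text \<open>By \<open>f_N\<close> the entries with all factors on the right determine all others of
  the same or larger total degree. The induction has the shape of
  \<open>f_Npow_eq_0\<close>.\<close>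

lemma gram_eq_above:
  assumes "u \<in> K i" "w \<in> K i"
    and eq: "\<And>j. k \<le> j \<Longrightarrow> f u ((N ^^ j) u) = f w ((N ^^ j) w)"
    and "k \<le> a + b"
  shows "f ((N ^^ a) u) ((N ^^ b) u) = f ((N ^^ a) w) ((N ^^ b) w)"
  using assms(4)
proof (induction a arbitrary: b)
  case 0
  then show ?case using eq by simp
next
  case (Suc a)
  show ?case
    using Suc.prems
  proof (induction "i - b" arbitrary: b)
    case 0
    then show ?case using K_Npow[OF assms(1)] K_Npow[OF assms(2)] by simp
  next
    case (Suc d)
    have "f ((N ^^ Suc a) u) ((N ^^ Suc b) u) = f ((N ^^ Suc a) w) ((N ^^ Suc b) w)"
      using Suc.hyps(2) Suc.prems by (intro Suc.hyps(1)) auto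
    moreover have "f ((N ^^ a) u) ((N ^^ Suc b) u) = f ((N ^^ a) w) ((N ^^ Suc b) w)"
      using Suc.prems by (intro Suc.IH) auto
    ultimately show ?case
      using f_N[of "(N ^^ a) u" "(N ^^ b) u"] f_N[of "(N ^^ a) w" "(N ^^ b) w"] by simp
  qed
qed

lemma gram_diff_top:
  assumes "u \<in> K i" "w \<in> K i"
    and eq: "\<And>j. Suc k \<le> j \<Longrightarrow> f u ((N ^^ j) u) = f w ((N ^^ j) w)"
    and "a + b = k"
  shows "f ((N ^^ a) u) ((N ^^ b) u) - f ((N ^^ a) w) ((N ^^ b) w) =
    (-1) ^ a * (f u ((N ^^ k) u) - f w ((N ^^ k) w))"
  using assms(4)
proof (induction a arbitrary: b)
  case (Suc a)
  have "f ((N ^^ Suc a) u) ((N ^^ Suc b) u) = f ((N ^^ Suc a) w) ((N ^^ Suc b) w)"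
    using Suc.prems by (intro gram_eq_above[OF assms(1,2) eq]) auto
  then have "f ((N ^^ Suc a) u) ((N ^^ b) u) - f ((N ^^ Suc a) w) ((N ^^ b) w) =
      - (f ((N ^^ a) u) ((N ^^ Suc b) u) - f ((N ^^ a) w) ((N ^^ Suc b) w))"
    using f_N[of "(N ^^ a) u" "(N ^^ b) u"] f_N[of "(N ^^ a) w" "(N ^^ b) w"] by simp
  also have "\<dots> = - ((-1) ^ a * (f u ((N ^^ k) u) - f w ((N ^^ k) w)))"
    using Suc.prems by (subst Suc.IH) auto
  finally show ?case by simp
qed auto

text \<open>
  The graph of a generalised unitary reflection: it sends \<open>p(N) u\<close> to \<open>p(N) w\<close> and fixes all vectors
  orthogonal to the cyclic subspace generated by \<open>u - w\<close>.
\<close>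

inductive glue :: "'b \<Rightarrow> 'b \<Rightarrow> 'b \<Rightarrow> 'b \<Rightarrow> bool" for u w where
  glue_Npow: "glue u w ((N ^^ j) u) ((N ^^ j) w)"
| glue_perp: "y \<in> V \<Longrightarrow> (\<And>j. f y ((N ^^ j) (u - w)) = 0) \<Longrightarrow> glue u w y y"
| glue_add: "glue u w x y \<Longrightarrow> glue u w x' y' \<Longrightarrow> glue u w (x + x') (y + y')"
| glue_scale: "glue u w x y \<Longrightarrow> glue u w (c *s x) (c *s y)"

lemma glue_V: "glue u w x y \<Longrightarrow> u \<in> V \<Longrightarrow> w \<in> V \<Longrightarrow> x \<in> V \<and> y \<in> V"
  by (induction rule: glue.induct) (auto simp: Npow_V V_closed)

lemma glue_sym: "glue u w x y \<Longrightarrow> glue w u y x"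
proof (induction rule: glue.induct)
  case (glue_perp y)
  have "f y ((N ^^ j) (w - u)) = 0" for j
    using glue_perp(2)[of j] by (simp add: Npow_simps f_simps)
  then show ?case using glue_perp(1) by (intro glue.glue_perp)
qed (auto intro: glue.intros)

text \<open>The orthogonal complement of the cyclic subspace of \<open>u - w\<close> is stable under
  \<open>N\<close>, by descent on \<open>j\<close> from the exponents where
  \<open>N^j (u - w)\<close> vanishes.\<close>

lemma glue_N:
  assumes "glue u w x y" "u \<in> K i" "w \<in> K i"
  shows "glue u w (N x) (N y)"
  using assms(1)
proof (induction rule: glue.induct)
  case (glue_Npow j)
  show ?case using glue.glue_Npow[of u w "Suc j"] by simp
next
  case (glue_perp y)
  let ?d = "u - w"
  have d: "?d \<in> K i" using assms by (simp add: K_closed)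
  have "f (N y) ((N ^^ j) ?d) = 0" for j
  proof (induction "i - j" arbitrary: j)
    case 0
    then show ?case using K_Npow[OF d] by simp
  next
    case (Suc k)
    then have "f (N y) ((N ^^ Suc j) ?d) = 0" by (intro Suc.hyps(1)) auto
    then show ?case using f_N[of y "(N ^^ j) ?d"] glue_perp(2)[of "Suc j"] by simp
  qed
  then show ?case using glue_perp(1) by (intro glue.glue_perp N_V)
qed (auto simp: N_add N_scale intro: glue.intros)

text \<open>Only the mixed case needs the choice of complement: a vector orthogonal to all
  \<open>N^j (u - w)\<close> pairs equally with \<open>N^j u\<close> and
  \<open>N^j w\<close>.\<close>

lemma glue_isometric:
  assumes "u \<in> K i" "w \<in> K i" and eq: "\<And>j. f u ((N ^^ j) u) = f w ((N ^^ j) w)"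
    and "glue u w x y" "glue u w x' y'"
  shows "f x x' = f y y'"
  using assms(4)
proof (induction rule: glue.induct)
  case (glue_Npow j)
  from assms(5) show ?case
  proof (induction rule: glue.induct)
    case (glue_Npow j')
    show ?case using gram_eq_above[OF assms(1,2), of 0] eq by simp
  next
    case (glue_perp y)
    then have "f ((N ^^ j) (u - w)) y = 0" using f_eq_0_sym by blast
    then show ?case by (simp add: Npow_simps f_simps)
  qed (auto simp: f_simps)
next
  case (glue_perp y)
  from assms(5) show ?case
  proof (induction rule: glue.induct)
    case (glue_Npow j')
    show ?case using glue_perp(2)[of j'] by (simp add: Npow_simps f_simps)
  qed (auto simp: f_simps)
qed (auto simp: f_simps)

text \<open>The matrix \<open>f (N^k u, N^j (u - w))\<close> vanishes for
  \<open>k + j \<ge> i\<close> and has entries \<open>\<plusminus> B i u (u - w) \<noteq> 0\<close>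
  for \<open>k + j = i - 1\<close>. This triangular shape lets multiples of \<open>N^k u\<close>
  clear the pairings of \<open>x\<close> with \<open>N^j (u - w)\<close> one by one, from
  \<open>j = i - 1\<close> down to 0.\<close>

lemma glue_total:
  assumes uw: "u \<in> K i" "w \<in> K i" and i: "i > 0" and nz: "B i u (u - w) \<noteq> 0" and x: "x \<in> V"
  obtains y where "glue u w x y"
proof -
  let ?d = "u - w"
  have d: "?d \<in> K i" using uw by (simp add: K_closed)
  have "\<exists>a b. glue u w a b \<and> (\<forall>j\<ge>i - k. f (x - a) ((N ^^ j) ?d) = 0)" if "k \<le> i" for k
    using that
  proof (induction k)
    case 0
    have "glue u w 0 0" using glue_scale[OF glue_Npow, of u w 0 0] by simp
    then show ?case using K_Npow[OF d] by (intro exI[of _ 0]) auto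
  next
    case (Suc k)
    then obtain a b where ab: "glue u w a b" "\<And>j. j \<ge> i - k \<Longrightarrow> f (x - a) ((N ^^ j) ?d) = 0"
      by auto
    define j0 where "j0 = i - Suc k"
    have j0: "k + j0 = i - 1" "i - k = Suc j0" using Suc.prems by (auto simp: j0_def)
    have ne: "f ((N ^^ k) u) ((N ^^ j0) ?d) \<noteq> 0"
      using f_Npow_top[OF uw(1) d j0(1) i] nz by (simp add: B_def)
    define c where "c = f (x - a) ((N ^^ j0) ?d) / f ((N ^^ k) u) ((N ^^ j0) ?d)"
    have "f (x - (a + c *s (N ^^ k) u)) ((N ^^ j) ?d) = 0" if "j \<ge> j0" for j
    proof (cases "j = j0")
      case True
      then show ?thesis using ne by (simp add: f_simps(1,3,5) c_def)
    next
      case False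
      then have "f ((N ^^ k) u) ((N ^^ j) ?d) = 0"
        using that j0 i by (intro f_Npow_eq_0[OF uw(1) d]) auto
      moreover have "f (x - a) ((N ^^ j) ?d) = 0" using that False j0 by (intro ab) auto
      ultimately show ?thesis by (simp add: f_simps(1,3,5))
    qed
    moreover have "glue u w (a + c *s (N ^^ k) u) (b + c *s (N ^^ k) w)"
      using ab by (intro glue_add glue_scale glue_Npow)
    ultimately show ?case unfolding j0_def by blast
  qed
  from this[of i] obtain a b where ab: "glue u w a b" "\<And>j. f (x - a) ((N ^^ j) ?d) = 0"
    by auto
  then have "x - a \<in> V" using glue_V[OF ab(1)] uw x by (auto simp: K_V V_closed)
  then have "glue u w (a + (x - a)) (b + (x - a))"
    using ab by (intro glue_add glue_perp)
  then show ?thesis using that by simp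
qed

text \<open>The relation \<open>glue\<close> is a function: if \<open>0\<close> is glued to
  \<open>y - y'\<close>, isometry makes \<open>y - y'\<close> orthogonal to all right-hand members,
  and these exhaust \<open>V\<close>.\<close>

lemma ex_isometry_mapping:
  assumes uw: "u \<in> K i" "w \<in> K i" and i: "i > 0" and nz: "B i u (u - w) \<noteq> 0"
    and eq: "\<And>j. f u ((N ^^ j) u) = f w ((N ^^ j) w)"
  obtains h where "h \<in> isometries" "h u = w"
proof -
  have V: "u \<in> V" "w \<in> V" using uw by (auto simp: K_V)
  have "B i w u = (-1) ^ (i - 1) * B i u w ^ q" by (rule B_herm[OF uw i])
  moreover have "B i u u = (-1) ^ (i - 1) * B i u u ^ q" by (rule B_herm[OF uw(1,1) i])
  moreover have eqB: "B i w w = B i u u" using eq by (simp add: B_def)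
  \<comment> \<open>The swapped pair satisfies the same nonvanishing condition; with
    \<open>glue_sym\<close> this shows that every vector of \<open>V\<close> occurs on the
    right.\<close>
  ultimately have "B i w (w - u) = (-1) ^ (i - 1) * B i u (u - w) ^ q"
    by (simp add: B_simps frob_diff algebra_simps)
  then have nz': "B i w (w - u) \<noteq> 0" using nz by simp
  have total: "\<exists>y. glue u w x y" if "x \<in> V" for x
    using glue_total[OF uw i nz that] by metis
  have range: "\<exists>x. glue u w x y" if "y \<in> V" for y
    using glue_total[OF uw(2,1) i nz' that] glue_sym by metis
  have unique: "y = y'" if "glue u w x y" "glue u w x y'" for x y y'
  proof -
    have "glue u w (x + (- 1) *s x) (y + (- 1) *s y')"
      using that by (intro glue_add glue_scale)
    then have 0: "glue u w 0 (y - y')" by simp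
    have "f (y - y') z = 0" if z: "z \<in> V" for z
      using range[OF z] glue_isometric[OF uw eq 0] by auto
    then show ?thesis using nondegenerate[of "y - y'"] glue_V[OF 0] V by auto
  qed
  define h where "h x = (THE y. glue u w x y)" for x
  have hI: "h x = y" if "glue u w x y" for x y
    unfolding h_def using that unique by blast
  have h: "glue u w x (h x)" if "x \<in> V" for x
    using total[OF that] hI by auto
  have "h \<in> isometries"
    unfolding isometries_def using h glue_V[OF _ V]
    by (auto intro!: hI glue_add glue_scale glue_N[OF _ uw] glue_isometric[OF uw eq, symmetric])
  moreover have "h u = w"
    using glue_Npow[of u w 0] by (intro hI) simp
  ultimately show ?thesis by (rule that)
qed

text \<open>Degrees are repaired one at a time, from \<open>i - 1\<close>, where equality is given,
  down to 0. In degree \<open>k = i - 1 - (m + 1)\<close> adding \<open>N^(m+1) y\<close> to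
  \<open>w'\<close> contributes \<open>t + (-1)^k t^q\<close> with \<open>t = B i w' y\<close> and
  changes no higher degree. The defect lies in the range of this trace map.\<close>

lemma ex_gram_lift:
  assumes uw: "u \<in> K i" "w \<in> K i" and i: "i > 0" and w: "w \<notin> rad i" and eq: "B i u u = B i w w"
  obtains z where "z \<in> K i" "\<And>j. f u ((N ^^ j) u) = f (w + N z) ((N ^^ j) (w + N z))"
proof -
  obtain z0 where z0: "z0 \<in> K i" "B i w z0 \<noteq> 0" using w uw by (auto simp: rad_def)
  have "\<exists>z\<in>K i. \<forall>j\<ge>i - 1 - m. f u ((N ^^ j) u) = f (w + N z) ((N ^^ j) (w + N z))"
    if "m \<le> i - 1" for m
    using that
  proof (induction m)
    case 0
    have "f u ((N ^^ j) u) = f w ((N ^^ j) w)" if "i - 1 \<le> j" for j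
    proof (cases "j = i - 1")
      case True
      then show ?thesis using eq by (simp add: B_def)
    next
      case False
      then have "i \<le> j" using that i by simp
      then show ?thesis using K_Npow[OF uw(1)] K_Npow[OF uw(2)] by simp
    qed
    then show ?case by (intro bexI[of _ 0]) (auto simp: K_closed)
  next
    case (Suc m)
    then obtain z where z: "z \<in> K i"
      and IH: "\<And>j. i - 1 - m \<le> j \<Longrightarrow> f u ((N ^^ j) u) = f (w + N z) ((N ^^ j) (w + N z))"
      by auto
    define w' where "w' = w + N z"
    have w': "w' \<in> K i" using uw z by (simp add: w'_def K_closed N_K)
    have Bw': "B i w' z0 \<noteq> 0" using z0 B_N_left[OF z0(1) i] by (simp add: w'_def B_simps)
    define k where "k = i - 1 - Suc m"
    have k: "Suc k = i - 1 - m" "k + Suc m = i - 1" using Suc.prems by (auto simp: k_def)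
    define x where "x = f u ((N ^^ k) u) - f w' ((N ^^ k) w')"
    have IH': "\<And>j. Suc k \<le> j \<Longrightarrow> f u ((N ^^ j) u) = f w' ((N ^^ j) w')"
      using IH k by (simp add: w'_def)
    \<comment> \<open>Hermitian symmetry moves all factors \<open>N\<close> to the left, and
      \<open>gram_diff_top\<close> moves them back at the price of the sign.\<close>
    have "x ^ q = f ((N ^^ k) u) u - f ((N ^^ k) w') w'"
      unfolding x_def frob_diff by (simp add: f_herm[symmetric])
    also have "\<dots> = (-1) ^ k * x"
      using gram_diff_top[OF uw(1) w' IH', where a = k and b = 0] by (simp add: x_def)
    finally have x: "x ^ q = (-1) ^ k * x" .
    obtain t where t: "t + (-1) ^ k * t ^ q = x"
      using trace_surj[OF sign_square frob_sign x] by blast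
    \<comment> \<open>Chosen so that \<open>B i w' (c *s z0) = t\<close>; the exponent
      \<open>q\<close> compensates semilinearity.\<close>
    define c where "c = (t / B i w' z0) ^ q"
    define y where "y = c *s z0"
    have y: "y \<in> K i" using z0 by (simp add: y_def K_closed)
    have By: "B i w' y = t" using Bw' by (simp add: y_def c_def B_simps)
    let ?v = "(N ^^ Suc m) y"
    have quad: "f (w' + ?v) ((N ^^ j) (w' + ?v)) =
        f w' ((N ^^ j) w') + f w' ((N ^^ (j + Suc m)) y) + f ?v ((N ^^ j) w') + f ?v ((N ^^ (j + Suc m)) y)" for j
      by (simp only: f_add f_add_right Npow_add Npow_Npow add_ac)
    have "f u ((N ^^ j) u) = f (w' + ?v) ((N ^^ j) (w' + ?v))" if "k \<le> j" for j
    proof (cases "j = k")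
      case True
      have "f w' ((N ^^ (k + Suc m)) y) = t"
        using By by (simp only: k B_def)
      moreover have "f ?v ((N ^^ k) w') = (-1) ^ Suc m * B i y w'"
        unfolding B_def using k by (intro f_Npow_top[OF y w' _ i]) simp
      moreover have "B i y w' = (-1) ^ (i - 1) * t ^ q"
        using B_herm[OF w' y i] By by simp
      moreover have "(-1) ^ Suc m * ((-1) ^ (i - 1) * t ^ q) = (-1) ^ k * t ^ q"
        using sign_square[of "Suc m"]
        by (simp only: k(2)[symmetric] power_add) (metis mult.assoc mult.commute mult.left_neutral)
      moreover have "f ?v ((N ^^ (k + Suc m)) y) = 0"
        using k i by (intro f_Npow_eq_0[OF y y]) simp
      ultimately show ?thesis
        unfolding True quad using t by (simp add: x_def add.assoc)
    next
      case False
      then have j: "Suc k \<le> j" using that by simp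
      then have "f w' ((N ^^ (j + Suc m)) y) = 0"
        using f_Npow_eq_0[OF w' y, of 0 "j + Suc m"] k i by simp
      moreover have "f ?v ((N ^^ j) w') = 0"
        using j k i by (intro f_Npow_eq_0[OF y w']) simp
      moreover have "f ?v ((N ^^ (j + Suc m)) y) = 0"
        using j k i by (intro f_Npow_eq_0[OF y y]) simp
      ultimately show ?thesis unfolding quad using IH'[OF j] by simp
    qed
    moreover have "w' + ?v = w + N (z + (N ^^ m) y)"
      by (simp add: w'_def N_add)
    moreover have "(N ^^ m) y \<in> K i"
      using Npow_K[OF y, of m] K_mono[of "i - m" i] by auto
    then have "z + (N ^^ m) y \<in> K i" using z by (simp add: K_closed)
    ultimately show ?case unfolding k_def by (intro bexI[of _ "z + (N ^^ m) y"]) auto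
  qed
  from this[of "i - 1"] show ?thesis using that by auto
qed

section \<open>When two cosets of \<open>N V\<close> lie in one orbit\<close>

lemma isometriesD:
  assumes "h \<in> isometries" "x \<in> V"
  shows "h x \<in> V" "y \<in> V \<Longrightarrow> h (x + y) = h x + h y" "h (c *s x) = c *s h x"
    "y \<in> V \<Longrightarrow> f (h x) (h y) = f x y" "h (N x) = N (h x)"
  using assms by (auto simp: isometries_def)

lemma isometries_Npow:
  assumes "h \<in> isometries" "x \<in> V"
  shows "h ((N ^^ k) x) = (N ^^ k) (h x)"
  by (induction k) (simp_all add: isometriesD[OF assms(1)] assms Npow_V)

lemma isometries_zero: "h \<in> isometries \<Longrightarrow> h 0 = 0"
  using isometriesD(3)[of h 0 0] V_closed(1) by simp

lemma isometries_K: "h \<in> isometries \<Longrightarrow> x \<in> K i \<Longrightarrow> h x \<in> K i"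
  using isometries_Npow[of h x i] isometriesD(1)[of h x] isometries_zero[of h]
  by (simp add: K_def)

lemma isometries_B:
  "h \<in> isometries \<Longrightarrow> x \<in> V \<Longrightarrow> y \<in> V \<Longrightarrow> B i (h x) (h y) = B i x y"
  by (simp add: B_def Npow_V isometriesD(4) flip: isometries_Npow)

lemma id_isometries: "(\<lambda>x. x) \<in> isometries"
  by (simp add: isometries_def)

lemma comp_isometries: "h \<in> isometries \<Longrightarrow> k \<in> isometries \<Longrightarrow> (\<lambda>x. h (k x)) \<in> isometries"
  by (simp add: isometries_def)

lemma scale_isometries: "c * c ^ q = 1 \<Longrightarrow> (\<lambda>x. c *s x) \<in> isometries"
  by (simp add: isometries_def V_closed N_scale f_simps algebra_simps flip: mult.assoc)

definition related :: "'b \<Rightarrow> 'b \<Rightarrow> bool" where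
  "related x y \<longleftrightarrow> (\<exists>h\<in>isometries. \<exists>z\<in>V. h x = y + N z)"

lemma relatedI: "h \<in> isometries \<Longrightarrow> z \<in> V \<Longrightarrow> h x = y + N z \<Longrightarrow> related x y"
  by (auto simp: related_def)

lemma related_trans:
  assumes "related x y" "related y w" "y \<in> V" "w \<in> V"
  shows "related x w"
proof -
  obtain h z k z' where h: "h \<in> isometries" "z \<in> V" "h x = y + N z"
    and k: "k \<in> isometries" "z' \<in> V" "k y = w + N z'"
    using assms(1,2) by (auto simp: related_def)
  have "k (h x) = w + N (z' + k z)"
    using h k assms by (simp add: isometriesD N_V N_add add.assoc)
  then show ?thesis
    using h k by (intro relatedI[OF comp_isometries[OF k(1) h(1)]]) (auto simp: V_closed isometriesD)
qed

lemma related_shift: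
  assumes "related u w" "x = u + N z" "y = w + N z'" "u \<in> V" "w \<in> V" "z \<in> V" "z' \<in> V"
  shows "related x y"
proof -
  obtain h t where h: "h \<in> isometries" "t \<in> V" "h u = w + N t"
    using assms(1) by (auto simp: related_def)
  have "h x = y + N (t + h z - z')"
    using h assms by (simp add: isometriesD N_V N_add N_diff)
  then show ?thesis
    using h assms by (intro relatedI[OF h(1)]) (auto simp: V_closed isometriesD)
qed

lemma related_generic:
  assumes uw: "u \<in> K i" "w \<in> K i" and i: "i > 0" and "w \<notin> rad i" and "B i u u = B i w w"
    and nz: "B i u (u - w) \<noteq> 0"
  shows "related u w"
proof -
  obtain z where z: "z \<in> K i"
    and eq: "\<And>j. f u ((N ^^ j) u) = f (w + N z) ((N ^^ j) (w + N z))"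
    using ex_gram_lift[OF assms(1-5)] by blast
  have "B i u (u - (w + N z)) = B i u (u - w)"
    using B_N_right[OF uw(1) i, of z] by (simp add: B_simps)
  then obtain h where "h \<in> isometries" "h u = w + N z"
    using ex_isometry_mapping[OF uw(1) _ i _ eq] nz uw z by (auto simp: K_closed N_K)
  then show ?thesis using K_V[OF z] by (intro relatedI)
qed

text \<open>Since \<open>u\<close> is isotropic, adding \<open>c *s u\<close> changes the value at
  \<open>z\<close> by \<open>t + (-1)^(i-1) t^q\<close> with \<open>t = c * B i u z\<close>, and
  such traces cover every possible difference.\<close>

lemma isotropic_shift:
  assumes uz: "u \<in> K i" "z \<in> K i" and i: "i > 0" and "B i u u = 0" "B i u z \<noteq> 0"
    and x: "x ^ q = (-1) ^ (i - 1) * x"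
  obtains c where "B i (z + c *s u) (z + c *s u) = x"
proof -
  let ?e = "(-1 :: 'a) ^ (i - 1)"
  have "(x - B i z z) ^ q = ?e * (x - B i z z)"
    using x B_self[OF uz(2) i] by (simp add: frob_diff algebra_simps)
  then obtain t where t: "t + ?e * t ^ q = x - B i z z"
    using trace_surj[OF sign_square frob_sign] by metis
  define c where "c = t / B i u z"
  have cu: "c *s u \<in> K i" using uz by (simp add: K_closed)
  have "B i (c *s u) z = t" using assms by (simp add: c_def B_simps)
  moreover have "B i z (c *s u) = ?e * B i (c *s u) z ^ q" by (rule B_herm[OF cu uz(2) i])
  moreover have "B i (c *s u) (c *s u) = 0" using assms by (simp add: B_simps)
  ultimately have "B i (z + c *s u) (z + c *s u) = x"
    unfolding B_simps(1,2) using t by (simp add: algebra_simps)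
  then show ?thesis by (rule that)
qed

lemma related_if_B_eq:
  assumes uw: "u \<in> K i" "w \<in> K i" and i: "i > 0" and nr: "u \<notin> rad i" "w \<notin> rad i"
    and eq: "B i u u = B i w w"
  shows "related u w"
proof -
  have V: "u \<in> V" "w \<in> V" using uw by (auto simp: K_V)
  show ?thesis
  proof (cases "B i u (u - w) = 0")
    case False
    then show ?thesis using assms by (intro related_generic)
  next
    case True
    then have Buw: "B i u w = B i u u" by (simp add: B_simps)
    show ?thesis
    proof (cases "B i u u = 0")
      case False
      \<comment> \<open>As \<open>B i u w = B i u u\<close>, replacing \<open>w\<close> by
        \<open>c *s w\<close> turns \<open>B i u (u - w)\<close> into
        \<open>(1 - c^q) * B i u u\<close>, which is nonzero.\<close>
      obtain c :: 'a where c: "c * c ^ q = 1" "c \<noteq> 1" by (rule ex_norm_one)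
      then have "c ^ q \<noteq> 1" by auto
      have cw: "c *s w \<in> K i" using uw by (simp add: K_closed)
      have Bc: "B i (c *s w) (c *s w) = B i w w" using c by (simp add: B_simps mult.assoc[symmetric] mult.commute)
      then have "c *s w \<notin> rad i" using False eq cw unfolding rad_def by (metis (mono_tags, lifting) mem_Collect_eq)
      moreover have "B i u (u - c *s w) = (1 - c ^ q) * B i u u"
        by (simp add: B_simps Buw algebra_simps)
      then have "B i u (u - c *s w) \<noteq> 0" using False \<open>c ^ q \<noteq> 1\<close> by simp
      ultimately have "related u (c *s w)"
        using uw cw i eq Bc by (intro related_generic) auto
      \<comment> \<open>The inverse of a scalar \<open>c\<close> of norm one is
        \<open>c^q\<close>.\<close>
      moreover have "related (c *s w) w"
        using c V by (intro relatedI[of "\<lambda>x. c ^ q *s x" 0] scale_isometries)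
          (auto simp: mult.commute V_closed)
      ultimately show ?thesis using V by (auto intro: related_trans simp: V_closed)
    next
      case 0: True
      then have Bwu: "B i w u = 0" using Buw B_eq_0_sym[OF uw i] by simp
      \<comment> \<open>A vector space is not the union of two proper subspaces: if
        \<open>z1\<close> and \<open>z2\<close> each fail on one side, their sum works.\<close>
      have "\<exists>z\<in>K i. B i u z \<noteq> 0 \<and> B i w z \<noteq> 0"
      proof -
        obtain z1 where z1: "z1 \<in> K i" "B i u z1 \<noteq> 0" using nr uw by (auto simp: rad_def)
        obtain z2 where z2: "z2 \<in> K i" "B i w z2 \<noteq> 0" using nr uw by (auto simp: rad_def)
        show ?thesis
        proof (cases "B i w z1 = 0")
          case w: True
          show ?thesis
          proof (cases "B i u z2 = 0")
            case True
            then show ?thesis using w z1 z2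
              by (intro bexI[of _ "z1 + z2"]) (auto simp: B_simps K_closed)
          qed (use z2 in blast)
        qed (use z1 in blast)
      qed
      then obtain z0 where z0: "z0 \<in> K i" "B i u z0 \<noteq> 0" "B i w z0 \<noteq> 0" by blast
      \<comment> \<open>Now \<open>u\<close> is isotropic and orthogonal to \<open>w\<close>, so
        shifting \<open>z0\<close> by it keeps both pairings nonzero. For the resulting isotropic
        \<open>z\<close> one has \<open>B i u (u - z) = - B i u z\<close> and
        \<open>B i z (z - w) = - B i z w\<close>, so the generic case applies twice.\<close>
      obtain c where c: "B i (z0 + c *s u) (z0 + c *s u) = 0"
        using isotropic_shift[OF uw(1) z0(1) i 0 z0(2), of 0] by auto
      define z where "z = z0 + c *s u"
      have z: "z \<in> K i" using z0 uw by (simp add: z_def K_closed)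
      have uz: "B i u z \<noteq> 0" and wz: "B i w z \<noteq> 0"
        using z0 0 Bwu by (auto simp: z_def B_simps)
      have "related u z"
        using uw z i 0 uz c B_eq_0_sym[OF uw(1) z i]
        by (intro related_generic) (auto simp: z_def[symmetric] rad_def B_simps)
      moreover have "related z w"
        using uw z i 0 eq nr wz c B_eq_0_sym[OF uw(2) z i]
        by (intro related_generic) (auto simp: z_def[symmetric] B_simps)
      ultimately show ?thesis using V z by (auto intro: related_trans simp: K_V)
    qed
  qed
qed

section \<open>The level and the complete invariant of a coset\<close>

text \<open>Because \<open>K 0\<close> is zero, level 0 singles out the coset
  \<open>N V\<close>.\<close>

definition lev :: "'b \<Rightarrow> nat" where
  "lev x = (LEAST i. \<exists>u\<in>K i. \<exists>z\<in>V. x = u + N z)"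

text \<open>
  A collision \<open>N^a x = N^b x\<close> with \<open>a < b\<close> puts \<open>x - N^(b-a) x\<close> into \<open>K a\<close>; this replaces the
  Fitting decomposition.
\<close>

lemma ex_lev:
  assumes "x \<in> V"
  shows "\<exists>i. \<exists>u\<in>K i. \<exists>z\<in>V. x = u + N z"
proof -
  have "finite (range (\<lambda>k. (N ^^ k) x))"
    by (rule finite_subset[OF _ finite_V]) (use Npow_V[OF assms] in auto)
  then have "\<not> inj (\<lambda>k. (N ^^ k) x)"
    using finite_imageD infinite_UNIV_nat by blast
  then obtain a b where ab: "a < b" "(N ^^ a) x = (N ^^ b) x"
    unfolding inj_on_def by (metis linorder_neqE_nat)
  define d where "d = b - Suc a"
  have b: "b = a + Suc d" using ab by (simp add: d_def)
  have "(N ^^ a) (x - (N ^^ Suc d) x) = 0"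
    by (simp only: Npow_diff Npow_Npow b[symmetric] ab(2) diff_self)
  then have "x - (N ^^ Suc d) x \<in> K a"
    using assms Npow_V[OF assms, of "Suc d"] V_closed(3) by (simp only: K_def mem_Collect_eq)
  moreover have "x = (x - (N ^^ Suc d) x) + N ((N ^^ d) x)" by simp
  ultimately show ?thesis using Npow_V[OF assms] by blast
qed

lemma lev_decomposition:
  assumes "x \<in> V"
  obtains u z where "u \<in> K (lev x)" "z \<in> V" "x = u + N z"
  using LeastI_ex[OF ex_lev[OF assms]] that unfolding lev_def by blast

lemma lev_le: "u \<in> K i \<Longrightarrow> z \<in> V \<Longrightarrow> lev (u + N z) \<le> i"
  unfolding lev_def by (rule Least_le) blast

lemma lev_not_rad:
  assumes "u \<in> K i" "z \<in> V" "lev (u + N z) = i" "i > 0"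
  shows "u \<notin> rad i"
proof
  assume "u \<in> rad i"
  then obtain t where t: "t \<in> V" "u - N t \<in> K (i - 1)" using rad_iff[OF assms(4)] by blast
  have eq: "(u - N t) + N (t + z) = u + N z" by (simp add: N_add)
  have "lev ((u - N t) + N (t + z)) \<le> i - 1"
    using t assms by (intro lev_le V_closed)
  then show False unfolding eq using assms by simp
qed

text \<open>Together with \<open>lev_not_rad\<close>: by \<open>rad_iff\<close> a representative in
  \<open>K i\<close> can be moved to \<open>K (i - 1)\<close> modulo \<open>N V\<close> exactly when
  it lies in \<open>rad i\<close>.\<close>

lemma lev_eqI:
  assumes "u \<in> K i" "u \<notin> rad i" "i > 0" "z \<in> V"
  shows "lev (u + N z) = i"
proof (rule ccontr)
  let ?x = "u + N z"
  assume "lev ?x \<noteq> i"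
  then have le: "lev ?x \<le> i - 1" using lev_le[OF assms(1,4)] by simp
  have "?x \<in> V" using assms by (simp add: K_V V_closed N_V)
  then obtain v t where v: "v \<in> K (lev ?x)" "t \<in> V" "?x = v + N t" by (rule lev_decomposition)
  have "u - N (t - z) = v" using v(3) by (simp add: N_diff algebra_simps)
  then have "u - N (t - z) \<in> K (i - 1)" using v(1) K_mono[OF le] by auto
  then show False using rad_iff[OF assms(3), of u] assms v by (auto simp: V_closed)
qed

lemma B_well_defined:
  assumes "u \<in> K i" "v \<in> K i" "u + N z = v + N t"
  shows "B i u u = B i v v"
proof (cases "i = 0")
  case False
  have v: "v = u + N (z - t)" using assms(3) by (simp add: N_diff algebra_simps)
  have "B i v v = B i v u + B i v (N (z - t))" by (subst (2) v) (simp add: B_simps)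
  also have "\<dots> = B i v u" using B_N_right[OF assms(2)] False by simp
  also have "\<dots> = B i u u + B i (N (z - t)) u" by (subst v) (simp add: B_simps)
  also have "\<dots> = B i u u" using B_N_left[OF assms(1)] False by simp
  finally show ?thesis by simp
qed (use assms in \<open>simp add: K_0\<close>)

text \<open>The choice of \<open>b\<close> is immaterial by the preceding lemma.\<close>

definition invariant :: "'b \<Rightarrow> nat \<times> 'a" where
  "invariant x = (lev x, SOME b. \<exists>u\<in>K (lev x). \<exists>z\<in>V. x = u + N z \<and> b = B (lev x) u u)"

lemma invariant_eq:
  assumes "u \<in> K i" "z \<in> V" "lev (u + N z) = i"
  shows "invariant (u + N z) = (i, B i u u)"
proof -
  have "(SOME b. \<exists>v\<in>K i. \<exists>t\<in>V. u + N z = v + N t \<and> b = B i v v) = B i u u"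
  proof (rule some_equality)
    show "\<exists>v\<in>K i. \<exists>t\<in>V. u + N z = v + N t \<and> B i u u = B i v v" using assms by blast
  next
    fix b assume "\<exists>v\<in>K i. \<exists>t\<in>V. u + N z = v + N t \<and> b = B i v v"
    then show "b = B i u u" using B_well_defined[OF assms(1)] by metis
  qed
  then show ?thesis by (simp add: invariant_def assms)
qed

text \<open>An isometry preserves \<open>B i\<close>, hence also the property of lying outside
  \<open>rad i\<close>, which fixes the level. The converse is \<open>related_if_B_eq\<close> for
  representatives, carried over to \<open>x\<close> and \<open>y\<close>.\<close>

lemma related_iff_invariant:
  assumes "x \<in> V" "y \<in> V"
  shows "related x y \<longleftrightarrow> invariant x = invariant y"
proof
  assume "related x y"
  then obtain h z where h: "h \<in> isometries" "z \<in> V" "h x = y + N z" by (auto simp: related_def)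
  define i where "i = lev x"
  obtain u t where u: "u \<in> K i" "t \<in> V" "x = u + N t"
    using lev_decomposition[OF assms(1)] i_def by metis
  have uV: "u \<in> V" using K_V[OF u(1)] .
  have hu: "h u \<in> K i" using isometries_K h u by blast
  have "h x = h u + N (h t)" using h u uV by (simp add: isometriesD N_V)
  then have y: "y = h u + N (h t - z)" using h(3) by (simp add: N_diff algebra_simps)
  have t': "h t - z \<in> V" using h u by (simp add: isometriesD V_closed)
  have "lev y = i"
  proof (cases "i = 0")
    case True
    then show ?thesis using lev_le[OF hu t'] y by simp
  next
    case False
    then have "u \<notin> rad i" using u i_def lev_not_rad by auto
    then obtain w where "w \<in> K i" "B i u w \<noteq> 0" using u by (auto simp: rad_def)
    then have "B i (h u) (h w) \<noteq> 0" "h w \<in> K i"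
      using isometries_B[OF h(1) uV, of w i] isometries_K[OF h(1)] K_V by auto
    then have "h u \<notin> rad i" by (auto simp: rad_def)
    then show ?thesis unfolding y using hu t' False by (intro lev_eqI) auto
  qed
  then have "invariant y = (i, B i (h u) (h u))"
    using invariant_eq[OF hu t'] y by simp
  moreover have "invariant x = (i, B i u u)"
    using invariant_eq[OF u(1,2)] u(3) i_def by simp
  ultimately show "invariant x = invariant y"
    using isometries_B[OF h(1) uV uV] by simp
next
  assume eq: "invariant x = invariant y"
  define i where "i = lev x"
  have i': "i = lev y" using eq by (simp add: invariant_def i_def)
  obtain u t where u: "u \<in> K i" "t \<in> V" "x = u + N t"
    using lev_decomposition[OF assms(1)] i_def by metis
  obtain w s where w: "w \<in> K i" "s \<in> V" "y = w + N s"
    using lev_decomposition[OF assms(2)] i' by metis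
  have B: "B i u u = B i w w"
    using eq invariant_eq[OF u(1,2)] invariant_eq[OF w(1,2)] u(3) w(3) i_def i' by simp
  have "related u w"
  proof (cases "i = 0")
    case True
    then have "u = w" using u w by (simp add: K_0)
    then show ?thesis by (intro relatedI[OF id_isometries V_closed(1)]) simp
  next
    case False
    then show ?thesis
      using u w B i_def i' by (intro related_if_B_eq[OF u(1) w(1)]) (auto dest: lev_not_rad)
  qed
  then show "related x y"
    by (rule related_shift[OF _ u(3) w(3) K_V[OF u(1)] K_V[OF w(1)] u(2) w(2)])
qed

section \<open>Counting the values of the invariant\<close>

definition norms :: "nat \<Rightarrow> 'a set" where
  "norms i = {B i u u | u. u \<in> K i - rad i}"

lemma rad_subset: "rad i \<subseteq> K i"
  by (auto simp: rad_def)

lemma invariant_image: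
  "invariant ` V = {(0, 0)} \<union> (SIGMA i:{i. 0 < i \<and> rad i \<noteq> K i}. norms i)" (is "_ = ?R")
proof (intro equalityI subsetI)
  fix p assume "p \<in> invariant ` V"
  then obtain x where x: "x \<in> V" "p = invariant x" by blast
  obtain u z where u: "u \<in> K (lev x)" "z \<in> V" "x = u + N z" using x(1) by (rule lev_decomposition)
  have p: "p = (lev x, B (lev x) u u)" using invariant_eq[OF u(1,2)] u(3) x(2) by simp
  show "p \<in> ?R"
  proof (cases "lev x = 0")
    case True
    then have "u = 0" using u by (simp add: K_0)
    then show ?thesis using p True by (simp add: B_def)
  next
    case False
    then have "u \<notin> rad (lev x)" using u lev_not_rad by auto
    then show ?thesis using p u False by (auto simp: norms_def)
  qed
next
  fix p assume "p \<in> ?R"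
  then consider "p = (0, 0)" | i u where "p = (i, B i u u)" "u \<in> K i" "u \<notin> rad i" "i > 0"
    by (auto simp: norms_def)
  then show "p \<in> invariant ` V"
  proof cases
    case 1
    have "invariant (0 + N 0) = (0, B 0 0 0)"
      using lev_le[of 0 0 0] by (intro invariant_eq) (simp_all add: K_0 V_closed)
    then have "p = invariant 0" using 1 by (simp add: B_def)
    then show ?thesis using V_closed(1) by blast
  next
    case 2
    then have "invariant (u + N 0) = p"
      using lev_eqI[of u i 0] by (simp add: invariant_eq V_closed del: N_zero)
    then have "p = invariant u" by simp
    then show ?thesis using K_V[OF 2(2)] by blast
  qed
qed

lemma norms_subset: "i > 0 \<Longrightarrow> norms i \<subseteq> {x. x ^ q = (-1) ^ (i - 1) * x}"
  using B_self by (auto simp: norms_def)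

lemma B_rad: "r \<in> rad i \<Longrightarrow> x \<in> K i \<Longrightarrow> i > 0 \<Longrightarrow> B i r x = 0 \<and> B i x r = 0"
  using B_eq_0_sym[of r i x] by (auto simp: rad_def)

text \<open>The preimage in \<open>K i\<close> of the line that \<open>u\<close> spans in
  \<open>K i / rad i\<close>.\<close>

definition line :: "nat \<Rightarrow> 'b \<Rightarrow> 'b set" where
  "line i u = (\<lambda>(c, r). c *s u + r) ` (UNIV \<times> rad i)"

lemma lineE:
  assumes "x \<in> line i u"
  obtains c r where "x = c *s u + r" "r \<in> rad i"
  using assms unfolding line_def by auto

lemma card_line:
  assumes "u \<in> K i" "u \<notin> rad i"
  shows "card (line i u) = q ^ 2 * card (rad i)"
proof -
  have "c = c'" if "c *s u + r = c' *s u + r'" "r \<in> rad i" "r' \<in> rad i" for c c' r r'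
  proof (rule ccontr)
    assume "c \<noteq> c'"
    then have "u = (1 / (c - c')) *s ((c - c') *s u)" by simp
    also have "(c - c') *s u = r' - r" using that by (simp add: algebra_simps)
    finally have "u = (1 / (c - c')) *s (r' - r)" .
    then have "u \<in> rad i"
      using that by (metis subspace_rad subspace_scale subspace_diff)
    then show False using assms by simp
  qed
  then have "inj_on (\<lambda>(c, r). c *s u + r) (UNIV \<times> rad i)"
    by (intro inj_onI) (clarsimp, metis add_left_cancel)
  then show ?thesis
    unfolding line_def by (simp add: card_image card_cartesian_product card_field)
qed

lemma line_subset: "u \<in> K i \<Longrightarrow> line i u \<subseteq> K i"
  using rad_subset by (auto simp: line_def intro!: K_closed(2,4))

lemma card_rad_pos: "card (rad i) > 0"
  using subspace_0[OF subspace_rad] finite_subset[OF rad_subset] by (auto simp: card_gt_0_iff)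

text \<open>Here \<open>K i / rad i\<close> has dimension one. Outside the radical
  \<open>B i\<close> takes the values \<open>c * c^q * B i u u\<close> with
  \<open>c \<noteq> 0\<close>, and by \<open>norm_surj\<close> these are all admissible values
  except 0.\<close>

lemma card_norms_line:
  assumes i: "i > 0" and card: "card (K i) = q ^ 2 * card (rad i)"
  shows "card (norms i) = q - 1"
proof -
  let ?e = "(-1 :: 'a) ^ (i - 1)"
  have q: "q > 1" using q_gt_1 .
  then have "q ^ 2 > 1" by (rule one_less_power) simp
  then have "rad i \<noteq> K i" using card card_rad_pos[of i] by auto
  then obtain u where u: "u \<in> K i" "u \<notin> rad i" using rad_subset by blast
  have K: "line i u = K i"
    using card_line[OF u] card line_subset[OF u(1)] by (intro card_subset_eq) auto
  have B: "B i (c *s u + r) (c *s u + r) = c * c ^ q * B i u u" if "r \<in> rad i" for c r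
  proof -
    have "r \<in> K i" using that rad_subset by auto
    then show ?thesis using B_rad[OF that _ i] u by (simp add: B_simps K_closed)
  qed
  have nz: "B i u u \<noteq> 0"
  proof
    assume 0: "B i u u = 0"
    have "B i u x = 0" if x: "x \<in> K i" for x
    proof -
      have "x \<in> line i u" using x K by simp
      then obtain c r where "x = c *s u + r" "r \<in> rad i" by (rule lineE)
      then show ?thesis using 0 B_rad[OF _ u(1) i] by (simp add: B_simps)
    qed
    then show False using u by (auto simp: rad_def)
  qed
  have "norms i = {x. x ^ q = ?e * x} - {0}"
  proof (intro equalityI subsetI)
    fix x assume x: "x \<in> norms i"
    then obtain v where v: "v \<in> K i" "v \<notin> rad i" "x = B i v v" by (auto simp: norms_def)
    have "v \<in> line i u" using v(1) K by simp
    then obtain c r where cr: "v = c *s u + r" "r \<in> rad i" by (rule lineE)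
    then have "c \<noteq> 0" using v by auto
    then have "x \<noteq> 0" using B[OF cr(2)] cr v nz by simp
    then show "x \<in> {x. x ^ q = ?e * x} - {0}" using norms_subset[OF i] x by auto
  next
    fix x assume x: "x \<in> {x. x ^ q = ?e * x} - {0}"
    \<comment> \<open>Both numbers carry the same sign under the \<open>q\<close>-th power, so their
      quotient lies in the subfield and is a norm.\<close>
    have "(x / B i u u) ^ q = (?e * x) / (?e * B i u u)"
      using x B_self[OF u(1) i] by (simp add: power_divide)
    also have "\<dots> = x / B i u u" by simp
    finally obtain t where t: "t * t ^ q = x / B i u u"
      using norm_surj[of "x / B i u u"] x nz by auto
    have "B i (t *s u) (t *s u) = t * t ^ q * B i u u" by (simp add: B_simps mult.assoc)
    also have "\<dots> = x" using nz by (simp add: t)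
    finally have "B i (t *s u) (t *s u) = x" .
    moreover have "t *s u \<in> K i" using u by (simp add: K_closed)
    moreover from calculation have "t *s u \<notin> rad i" using x by (auto simp: rad_def)
    ultimately show "x \<in> norms i" unfolding norms_def by blast
  qed
  then show ?thesis
    using card_frob_eigenspace[OF sign_square frob_sign, of "i - 1"]
    by (simp add: card_Diff_singleton)
qed

text \<open>In dimension at least two there is an isotropic \<open>u\<close> outside the radical:
  either one is at hand, or two orthogonal vectors are combined. Shifting a vector \<open>z\<close>
  with \<open>B i u z \<noteq> 0\<close> along \<open>u\<close> then gives every admissible value,
  and the pairing with \<open>u\<close> keeps the shifted vector outside \<open>rad i\<close> even
  for the value 0.\<close>

lemma card_norms_large:
  assumes i: "i > 0" and card: "card (K i) > q ^ 2 * card (rad i)"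
  shows "card (norms i) = q"
proof -
  let ?e = "(-1 :: 'a) ^ (i - 1)"
  have q: "q > 1" using q_gt_1 .
  then have "q ^ 2 > 1" by (rule one_less_power) simp
  then have "1 * card (rad i) < q ^ 2 * card (rad i)"
    using card_rad_pos by (intro mult_strict_right_mono)
  then have "rad i \<noteq> K i" using card by auto
  then obtain u0 where u0: "u0 \<in> K i" "u0 \<notin> rad i" using rad_subset by blast
  obtain u where u: "u \<in> K i" "u \<notin> rad i" "B i u u = 0"
  proof (cases "B i u0 u0 = 0")
    case False
    have "line i u0 \<noteq> K i" using card card_line[OF u0] by auto
    then obtain w where w: "w \<in> K i" "w \<notin> line i u0" using line_subset[OF u0(1)] by blast
    define d where "d = B i w u0 / B i u0 u0"
    define v where "v = w - d *s u0"
    have v: "v \<in> K i" using w u0 by (simp add: v_def K_closed)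
    have wv: "w = (\<lambda>(c, r). c *s u0 + r) (d, v)" by (simp add: v_def)
    have "v \<notin> rad i"
    proof
      assume "v \<in> rad i"
      then have "w \<in> line i u0" unfolding line_def by (subst wv) (rule imageI, simp)
      then show False using w by simp
    qed
    have vu: "B i v u0 = 0" using False by (simp add: v_def d_def B_simps)
    then have uv: "B i u0 v = 0" using B_eq_0_sym[OF u0(1) v i] by simp
    show ?thesis
    proof (cases "B i v v = 0")
      case True
      then show ?thesis using v \<open>v \<notin> rad i\<close> that by blast
    next
      case vv: False
      \<comment> \<open>A scalar \<open>t\<close> of this norm makes \<open>u0 + t *s v\<close>
        isotropic, as \<open>u0\<close> and \<open>v\<close> are orthogonal.\<close>
      have "(- B i u0 u0 / B i v v) ^ q = - (?e * B i u0 u0) / (?e * B i v v)"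
        using B_self[OF u0(1) i] B_self[OF v i] by (simp add: power_divide frob_uminus)
      also have "\<dots> = - B i u0 u0 / B i v v" by simp
      finally obtain t where t: "t * t ^ q = - B i u0 u0 / B i v v"
        using norm_surj[of "- B i u0 u0 / B i v v"] vv False by auto
      let ?u = "u0 + t *s v"
      have "B i ?u ?u = B i u0 u0 + t * t ^ q * B i v v"
        by (simp add: B_simps uv vu)
      also have "\<dots> = 0" using vv by (simp add: t)
      finally have "B i ?u ?u = 0" .
      moreover have "B i ?u u0 \<noteq> 0" using False vu by (simp add: B_simps)
      then have "?u \<notin> rad i" using u0 by (auto simp: rad_def)
      moreover have "?u \<in> K i" using u0 v by (simp add: K_closed)
      ultimately show ?thesis using that by blast
    qed
  qed (use u0 that in blast)
  obtain z where z: "z \<in> K i" "B i u z \<noteq> 0" using u by (auto simp: rad_def)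
  have "norms i = {x. x ^ q = ?e * x}"
  proof (rule equalityI[OF norms_subset[OF i]], rule subsetI)
    fix x assume "x \<in> {x. x ^ q = ?e * x}"
    then obtain c where c: "B i (z + c *s u) (z + c *s u) = x"
      using isotropic_shift[OF u(1) z(1) i u(3) z(2), of x] by auto
    have "B i u (z + c *s u) \<noteq> 0" using z u by (simp add: B_simps)
    moreover have v: "z + c *s u \<in> K i" using z u by (simp add: K_closed)
    ultimately have "z + c *s u \<notin> rad i" using B_rad[OF _ u(1) i] by blast
    then show "x \<in> norms i" using c v unfolding norms_def by blast
  qed
  then show ?thesis
    using card_frob_eigenspace[OF sign_square frob_sign, of "i - 1"] by simp
qed

text \<open>The exponent \<open>m i\<close> is the dimension of \<open>K i / rad i\<close> and will
  be the multiplicity of the part \<open>i\<close>. Each part size contributes \<open>q\<close>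
  values, or \<open>q - 1\<close> if it is simple.\<close>

lemma card_invariant_image:
  assumes m: "\<And>i. i > 0 \<Longrightarrow> card (K i) = (q ^ 2) ^ m i * card (rad i)"
    and fin: "finite {i. 0 < i \<and> 0 < m i}"
  shows "int (card (invariant ` V)) =
    1 + int q * int (card {i. 0 < i \<and> 0 < m i}) - int (card {i. 0 < i \<and> m i = 1})"
proof -
  let ?S = "{i. 0 < i \<and> 0 < m i}"
  have q: "q > 1" using q_gt_1 .
  then have q2: "q ^ 2 > 1" by (rule one_less_power) simp
  have S: "{i. 0 < i \<and> rad i \<noteq> K i} = ?S"
  proof (intro Collect_cong conj_cong refl)
    fix i :: nat assume i: "0 < i"
    have "rad i = K i \<longleftrightarrow> card (rad i) = card (K i)"
      using rad_subset[of i] by (metis card_subset_eq finite_K)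
    also have "\<dots> \<longleftrightarrow> (q ^ 2) ^ m i = 1" using m[OF i] card_rad_pos[of i]
      by (metis mult_1 mult_cancel2 less_irrefl)
    also have "\<dots> \<longleftrightarrow> m i = 0" using q nat_power_eq_Suc_0_iff[of "q ^ 2" "m i"] by simp
    finally show "rad i \<noteq> K i \<longleftrightarrow> 0 < m i" by simp
  qed
  have norms: "int (card (norms i)) = int q - (if m i = 1 then 1 else 0)" if i: "i \<in> ?S" for i
  proof (cases "m i = 1")
    case True
    then show ?thesis using card_norms_line[of i] m[of i] i q by auto
  next
    case False
    then have "(q ^ 2) ^ 1 < (q ^ 2) ^ m i"
      using i q2 by (intro power_strict_increasing) auto
    then have "q ^ 2 * card (rad i) < card (K i)"
      using m[of i] i card_rad_pos[of i] by (simp add: mult_less_mono1)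
    then show ?thesis using card_norms_large[of i] False i by auto
  qed
  have "card (invariant ` V) = Suc (card (SIGMA i:?S. norms i))"
    unfolding invariant_image S using fin by (simp add: card_insert_disjoint finite_SigmaI)
  also have "card (SIGMA i:?S. norms i) = (\<Sum>i\<in>?S. card (norms i))"
    using fin by (intro card_SigmaI) auto
  finally have "int (card (invariant ` V)) = 1 + (\<Sum>i\<in>?S. int (card (norms i)))" by simp
  also have "(\<Sum>i\<in>?S. int (card (norms i))) = (\<Sum>i\<in>?S. int q - (if m i = 1 then 1 else 0))"
    using norms by (intro sum.cong) auto
  also have "\<dots> = int q * int (card ?S) - (\<Sum>i\<in>?S. if m i = 1 then 1 else 0)"
    by (simp add: sum_subtractf)
  also have "(\<Sum>i\<in>?S. if m i = 1 then 1 else 0 :: int) = int (card {i\<in>?S. m i = 1})"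
    using fin by (simp add: sum.If_cases Int_def)
  also have "{i\<in>?S. m i = 1} = {i. 0 < i \<and> m i = 1}" by auto
  finally show ?thesis by simp
qed

end

section \<open>Jordan blocks for an eigenvalue\<close>

lemma char_matrix_inverse:
  fixes B :: "'a::field mat"
  assumes B: "B \<in> carrier_mat m m" and ev: "\<not> eigenvalue B a"
  obtains M where "M \<in> carrier_mat m m" "M * char_matrix B a = 1\<^sub>m m"
proof -
  have "det (char_matrix B a) \<noteq> 0" using ev eigenvalue_det[OF B] by simp
  from det_non_zero_imp_unit[OF char_matrix_closed[OF B] this, of "()"]
  show ?thesis using that unfolding Units_def ring_mat_def by auto
qed

text \<open>
  The corner entry is removed by conjugation with a block unipotent matrix; since only the first
  row of \<open>R\<close> is nonzero, the Sylvester equation involved reduces to inverting \<open>B - a\<close>.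
\<close>

lemma similar_split_corner:
  fixes U B R :: "'a::field mat"
  assumes U: "U \<in> carrier_mat k k" and B: "B \<in> carrier_mat m m" and R: "R \<in> carrier_mat k m"
    and ev: "\<not> eigenvalue B a"
    and col: "\<And>i. i < k \<Longrightarrow> U $$ (i, 0) = (if i = 0 then a else 0)"
    and rows: "\<And>i j. i < k \<Longrightarrow> i \<noteq> 0 \<Longrightarrow> j < m \<Longrightarrow> R $$ (i, j) = 0"
  shows "similar_mat (four_block_mat U R (0\<^sub>m m k) B) (four_block_mat U (0\<^sub>m k m) (0\<^sub>m m k) B)"
proof -
  obtain M where M: "M \<in> carrier_mat m m" "M * char_matrix B a = 1\<^sub>m m"
    using char_matrix_inverse[OF B ev] by blast
  define X where "X = R * M"
  have X: "X \<in> carrier_mat k m" using R M by (simp add: X_def)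
  have rowsX: "X $$ (i, j) = 0" if "i < k" "i \<noteq> 0" "j < m" for i j
    using that R M rows by (auto simp: X_def scalar_prod_def)
  have UX: "U * X = a \<cdot>\<^sub>m X"
  proof (rule eq_matI)
    fix i j assume "i < dim_row (a \<cdot>\<^sub>m X)" "j < dim_col (a \<cdot>\<^sub>m X)"
    then have ij: "i < k" "j < m" using X by auto
    have "(U * X) $$ (i, j) = (\<Sum>l\<in>{0..<k}. U $$ (i, l) * X $$ (l, j))"
      using U X ij by (simp add: scalar_prod_def)
    also have "\<dots> = (\<Sum>l\<in>{0}. U $$ (i, l) * X $$ (l, j))"
      using ij rowsX by (intro sum.mono_neutral_right) auto
    also have "\<dots> = (a \<cdot>\<^sub>m X) $$ (i, j)"
      using ij X col rowsX by simp
    finally show "(U * X) $$ (i, j) = (a \<cdot>\<^sub>m X) $$ (i, j)" .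
  qed (use U X in auto)
  have "X * char_matrix B a = R"
    using M R B by (simp add: X_def assoc_mult_mat[of R k m M m "char_matrix B a" m])
  moreover have "X * char_matrix B a = X * B - a \<cdot>\<^sub>m X"
    using X B unfolding char_matrix_def
    by (subst mult_add_distrib_mat[of X k m B m]) auto
  ultimately have XB: "X * B - a \<cdot>\<^sub>m X = R" by simp
  let ?P = "four_block_mat (1\<^sub>m k) X (0\<^sub>m m k) (1\<^sub>m m)"
  let ?Q = "four_block_mat (1\<^sub>m k) (- X) (0\<^sub>m m k) (1\<^sub>m m)"
  let ?D = "four_block_mat U (0\<^sub>m k m) (0\<^sub>m m k) B"
  have one: "four_block_mat (1\<^sub>m k) (0\<^sub>m k m) (0\<^sub>m m k) (1\<^sub>m m) = (1\<^sub>m (k + m) :: 'a mat)"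
    by (rule eq_matI) auto
  have unipotent: "four_block_mat (1\<^sub>m k) Y (0\<^sub>m m k) (1\<^sub>m m) * four_block_mat (1\<^sub>m k) Z (0\<^sub>m m k) (1\<^sub>m m)
      = 1\<^sub>m (k + m)" if Y: "Y \<in> carrier_mat k m" and Z: "Z \<in> carrier_mat k m" and 0: "Z + Y = 0\<^sub>m k m"
    for Y Z :: "'a mat"
  proof -
    have "four_block_mat (1\<^sub>m k) Y (0\<^sub>m m k) (1\<^sub>m m) * four_block_mat (1\<^sub>m k) Z (0\<^sub>m m k) (1\<^sub>m m)
      = four_block_mat (1\<^sub>m k * 1\<^sub>m k + Y * 0\<^sub>m m k) (1\<^sub>m k * Z + Y * 1\<^sub>m m)
          (0\<^sub>m m k * 1\<^sub>m k + 1\<^sub>m m * 0\<^sub>m m k) (0\<^sub>m m k * Z + 1\<^sub>m m * 1\<^sub>m m)"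
      by (rule mult_four_block_mat) (use Y Z in auto)
    also have "\<dots> = four_block_mat (1\<^sub>m k) (0\<^sub>m k m) (0\<^sub>m m k) (1\<^sub>m m)"
      using Y Z 0 by simp
    finally show ?thesis using one by simp
  qed
  have "- X + X = 0\<^sub>m k m" "X + - X = 0\<^sub>m k m"
    using X by (auto intro!: eq_matI)
  then have PQ: "?P * ?Q = 1\<^sub>m (k + m)" "?Q * ?P = 1\<^sub>m (k + m)"
    using X by (auto intro!: unipotent)
  have "?P * ?D = four_block_mat U (X * B) (0\<^sub>m m k) B"
    using X U B by (subst mult_four_block_mat[of _ k k _ m _ m _ _ k _ m]) auto
  then have "?P * ?D * ?Q = four_block_mat U (U * (- X) + X * B) (0\<^sub>m m k) B"
    using X U B by (simp only:, subst mult_four_block_mat[of _ k k _ m _ m _ _ k _ m]) auto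
  also have "U * (- X) + X * B = R"
  proof -
    have "U * (- X) = - (a \<cdot>\<^sub>m X)"
      using U X UX by (simp add: uminus_mult_right_mat)
    then show ?thesis
      using X B by (subst XB[symmetric], intro eq_matI) auto
  qed
  finally show ?thesis
    using U B R X PQ by (intro similar_matI[of _ _ ?P ?Q "k + m"]) auto
qed

text \<open>An eigenvector is completed to a basis of which it is the first member.\<close>

lemma similar_eigenvector_column:
  fixes A :: "'a::field mat"
  assumes A: "A \<in> carrier_mat (Suc n) (Suc n)" and ev: "eigenvalue A a"
  obtains r A' where "r \<in> carrier_mat 1 n" "A' \<in> carrier_mat n n"
    "similar_mat A (four_block_mat (mat 1 1 (\<lambda>_. a)) r (0\<^sub>m n 1) A')"
proof -
  let ?n = "Suc n"
  obtain v where v: "v \<in> carrier_vec ?n" "v \<noteq> 0\<^sub>v ?n" "A *\<^sub>v v = a \<cdot>\<^sub>v v"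
    using ev A by (auto simp: eigenvalue_def eigenvector_def)
  then obtain p where p: "p < ?n" "v $ p \<noteq> 0"
    by (metis carrier_vecD eq_vecI index_zero_vec)
  \<comment> \<open>Columns of \<open>P\<close>: first \<open>v\<close>, then all unit vectors
    except the one at \<open>p\<close>, which \<open>v\<close> replaces because \<open>v $ p\<close>
    is nonzero. Column \<open>p\<close>, if it is not the first, receives the unit vector at
    0.\<close>
  define s where "s j = (if j = p then 0 else j)" for j :: nat
  define P where "P = mat ?n ?n (\<lambda>(i, j). if j = 0 then v $ i else if i = s j then 1 else 0)"
  have P: "P \<in> carrier_mat ?n ?n" by (simp add: P_def)
  have "det P \<noteq> 0"
  proof
    assume "det P = 0"
    then obtain x where x: "x \<in> carrier_vec ?n" "x \<noteq> 0\<^sub>v ?n" "P *\<^sub>v x = 0\<^sub>v ?n"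
      using det_0_iff_vec_prod_zero_field[OF P] by blast
    have Px: "(P *\<^sub>v x) $ i = v $ i * x $ 0 + (\<Sum>j\<in>{1..<?n}. (if i = s j then x $ j else 0))"
      if "i < ?n" for i
    proof -
      have "(P *\<^sub>v x) $ i = (\<Sum>j\<in>{0..<?n}. P $$ (i, j) * x $ j)"
        using that P x(1) by (simp add: scalar_prod_def del: sum.op_ivl_Suc)
      also have "\<dots> = P $$ (i, 0) * x $ 0 + (\<Sum>j\<in>{1..<?n}. P $$ (i, j) * x $ j)"
        by (subst sum.atLeast_Suc_lessThan) auto
      also have "(\<Sum>j\<in>{1..<?n}. P $$ (i, j) * x $ j) = (\<Sum>j\<in>{1..<?n}. if i = s j then x $ j else 0)"
        using that by (intro sum.cong) (auto simp: P_def)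
      finally show ?thesis using that by (simp add: P_def)
    qed
    have "(\<Sum>j\<in>{1..<?n}. if p = s j then x $ j else 0) = 0"
      by (intro sum.neutral) (auto simp: s_def)
    then have x0: "x $ 0 = 0"
      using Px[OF p(1)] x(3) p by simp
    have "x $ l = 0" if l: "l < ?n" for l
    proof (cases "l = 0")
      case False
      have sl: "s l < ?n" using l by (simp add: s_def)
      have "s l = s j \<longleftrightarrow> j = l" if "j \<in> {1..<?n}" for j
        using that False by (auto simp: s_def)
      then have "(\<Sum>j\<in>{1..<?n}. if s l = s j then x $ j else 0) = (\<Sum>j\<in>{1..<?n}. if j = l then x $ j else 0)"
        by (intro sum.cong) auto
      also have "\<dots> = x $ l" using False l by simp
      finally show ?thesis using Px[OF sl] x(3) x0 sl by simp
    qed (use x0 in simp)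
    then have "x = 0\<^sub>v ?n" using x(1) by (intro eq_vecI) auto
    then show False using x by simp
  qed
  from det_non_zero_imp_unit[OF P this, of "()"]
  obtain Q where Q: "Q \<in> carrier_mat ?n ?n" "Q * P = 1\<^sub>m ?n" "P * Q = 1\<^sub>m ?n"
    unfolding Units_def ring_mat_def by auto
  define C where "C = Q * A * P"
  have C: "C \<in> carrier_mat ?n ?n" using A P Q by (simp add: C_def)
  have "P * C * Q = A"
  proof -
    have "P * C * Q = P * (Q * A)"
      using A P Q by (simp add: C_def assoc_mult_mat[of _ ?n ?n _ ?n _ ?n])
    also have "\<dots> = P * Q * A"
      using A P Q by (intro assoc_mult_mat[symmetric])
    finally show ?thesis using Q A by simp
  qed
  then have sim: "similar_mat A C"
    using A P Q C by (intro similar_matI[of _ _ P Q ?n]) auto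
  have e0: "P *\<^sub>v unit_vec ?n 0 = v"
    using v P by (intro eq_vecI) (auto simp: P_def)
  have "Q *\<^sub>v (P *\<^sub>v unit_vec ?n 0) = Q * P *\<^sub>v unit_vec ?n 0"
    using P Q by (intro assoc_mult_mat_vec[symmetric]) auto
  then have Qv: "Q *\<^sub>v v = unit_vec ?n 0"
    using e0 Q(2) by simp
  have "C *\<^sub>v unit_vec ?n 0 = Q *\<^sub>v (A *\<^sub>v (P *\<^sub>v unit_vec ?n 0))"
    using A P Q by (simp add: C_def assoc_mult_mat_vec[of _ ?n ?n _ ?n])
  also have "\<dots> = a \<cdot>\<^sub>v unit_vec ?n 0"
    unfolding e0 v(3) using Q v Qv by (simp add: mult_mat_vec)
  finally have C0: "C *\<^sub>v unit_vec ?n 0 = a \<cdot>\<^sub>v unit_vec ?n 0" .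
  have col: "C $$ (i, 0) = (if i = 0 then a else 0)" if "i < ?n" for i
  proof -
    have "(C *\<^sub>v unit_vec ?n 0) $ i = C $$ (i, 0)" using that C by simp
    then show ?thesis using C0 that by (auto split: if_splits)
  qed
  define r where "r = mat 1 n (\<lambda>(i, j). C $$ (0, Suc j))"
  define A' where "A' = mat n n (\<lambda>(i, j). C $$ (Suc i, Suc j))"
  have "C = four_block_mat (mat 1 1 (\<lambda>_. a)) r (0\<^sub>m n 1) A'"
    using C col by (intro eq_matI) (auto simp: r_def A'_def)
  then show ?thesis using sim by (intro that[of r A']) (auto simp: r_def A'_def)
qed

lemma similar_mat_carrier:
  assumes "similar_mat A B" "A \<in> carrier_mat n n"
  shows "B \<in> carrier_mat n n"
proof -
  obtain N where "A \<in> carrier_mat N N" "B \<in> carrier_mat N N"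
    using similar_matD[OF assms(1)] by blast
  then show ?thesis using assms(2) by (metis carrier_matD(1))
qed

text \<open>By induction on the dimension: one eigenvector is split off, the remaining block is
  treated recursively, and \<open>similar_split_corner\<close> removes what the new first row leaves
  above \<open>B\<close>.\<close>

lemma split_eigenvalue:
  fixes A :: "'a::field mat"
  assumes "A \<in> carrier_mat n n"
  shows "\<exists>k m U B. U \<in> carrier_mat k k \<and> B \<in> carrier_mat m m \<and> upper_triangular U \<and>
    (\<forall>i<k. U $$ (i, i) = a) \<and> \<not> eigenvalue B a \<and>
    similar_mat A (four_block_mat U (0\<^sub>m k m) (0\<^sub>m m k) B)"
  using assms
proof (induction n arbitrary: A)
  case (0 A)
  have "\<not> eigenvalue A a" using eigenvalue_imp_nonzero_dim[OF 0] by blast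
  moreover have "four_block_mat (0\<^sub>m 0 0) (0\<^sub>m 0 0) (0\<^sub>m 0 0) A = A"
    using 0 by (intro eq_matI) auto
  then have "similar_mat A (four_block_mat (0\<^sub>m 0 0) (0\<^sub>m 0 0) (0\<^sub>m 0 0) A)"
    using similar_mat_refl[OF 0] by simp
  ultimately show ?case using 0
    by (intro exI[of _ 0] exI[of _ "0\<^sub>m 0 0"] exI[of _ A]) auto
next
  case (Suc n A)
  show ?case
  proof (cases "eigenvalue A a")
    case False
    have "four_block_mat (0\<^sub>m 0 0) (0\<^sub>m 0 (Suc n)) (0\<^sub>m (Suc n) 0) A = A"
      using Suc.prems by (intro eq_matI) auto
    then have "similar_mat A (four_block_mat (0\<^sub>m 0 0) (0\<^sub>m 0 (Suc n)) (0\<^sub>m (Suc n) 0) A)"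
      using similar_mat_refl[OF Suc.prems] by simp
    then show ?thesis using False Suc.prems
      by (intro exI[of _ 0] exI[of _ "Suc n"] exI[of _ "0\<^sub>m 0 0"] exI[of _ A]) auto
  next
    case True
    let ?a = "mat 1 1 (\<lambda>_. a)"
    obtain r A' where r: "r \<in> carrier_mat 1 n" and A': "A' \<in> carrier_mat n n"
      and sim: "similar_mat A (four_block_mat ?a r (0\<^sub>m n 1) A')"
      using similar_eigenvector_column[OF Suc.prems True] by blast
    obtain k m U B where U: "U \<in> carrier_mat k k" and B: "B \<in> carrier_mat m m"
      and tri: "upper_triangular U" and diag: "\<And>i. i < k \<Longrightarrow> U $$ (i, i) = a"
      and ev: "\<not> eigenvalue B a"
      and sim': "similar_mat A' (four_block_mat U (0\<^sub>m k m) (0\<^sub>m m k) B)"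
      using Suc.IH[OF A'] by blast
    have n: "n = k + m"
      using carrier_matD(1)[OF similar_mat_carrier[OF sim' A']] U B by simp
    obtain R where R: "R \<in> carrier_mat 1 n"
      and simR: "similar_mat (four_block_mat ?a r (0\<^sub>m n 1) A')
        (four_block_mat ?a R (0\<^sub>m n 1) (four_block_mat U (0\<^sub>m k m) (0\<^sub>m m k) B))"
      using similar_mat_four_block_0_ex[OF similar_mat_refl[of ?a 1] sim' r _ A'] by auto
    \<comment> \<open>The row \<open>R\<close> is cut after \<open>k\<close> entries, so that
      \<open>U'\<close> has first column \<open>(a, 0, ..., 0)\<close> and \<open>R'\<close> lives
      in the first row, as \<open>similar_split_corner\<close> demands.\<close>
    define U' where "U' = four_block_mat ?a (mat 1 k (\<lambda>(i, j). R $$ (0, j))) (0\<^sub>m k 1) U"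
    define R' where "R' = mat (Suc k) m (\<lambda>(i, j). if i = 0 then R $$ (0, k + j) else 0)"
    have U': "U' \<in> carrier_mat (Suc k) (Suc k)" using U by (auto simp: U'_def)
    have eq: "four_block_mat ?a R (0\<^sub>m n 1) (four_block_mat U (0\<^sub>m k m) (0\<^sub>m m k) B) =
        four_block_mat U' R' (0\<^sub>m m (Suc k)) B"
      using U B R n by (intro eq_matI) (auto simp: U'_def R'_def)
    have "similar_mat (four_block_mat U' R' (0\<^sub>m m (Suc k)) B)
        (four_block_mat U' (0\<^sub>m (Suc k) m) (0\<^sub>m m (Suc k)) B)"
      using U by (intro similar_split_corner[OF U' B _ ev]) (auto simp: U'_def R'_def)
    then have "similar_mat A (four_block_mat U' (0\<^sub>m (Suc k) m) (0\<^sub>m m (Suc k)) B)"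
      using sim simR eq by (metis similar_mat_trans)
    moreover have "upper_triangular U'"
      using U tri by (auto simp: U'_def upper_triangular_def)
    moreover have "\<forall>i<Suc k. U' $$ (i, i) = a"
      using U diag by (auto simp: U'_def)
    ultimately show ?thesis using U' B ev by blast
  qed
qed

text \<open>The triangular part has a Jordan form over the given field, and each of its block
  eigenvalues is a root of the characteristic polynomial, hence a diagonal entry, hence
  \<open>a\<close>.\<close>

lemma ex_jordan_blocks_at:
  fixes A :: "'a::field mat"
  assumes "A \<in> carrier_mat n n"
  shows "\<exists>ks. jordan_blocks_at A a ks"
proof -
  obtain k m U B where U: "U \<in> carrier_mat k k" and B: "B \<in> carrier_mat m m"
    and tri: "upper_triangular U" and diag: "\<And>i. i < k \<Longrightarrow> U $$ (i, i) = a"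
    and ev: "\<not> eigenvalue B a"
    and sim: "similar_mat A (four_block_mat U (0\<^sub>m k m) (0\<^sub>m m k) B)"
    using split_eigenvalue[OF assms] by blast
  obtain n_as where jnf: "jordan_nf U n_as"
    using triangular_to_jnf_vector[OF U tri] by blast
  have "snd p = a" if "p \<in> set n_as" for p
  proof -
    obtain l b where p: "p = (l, b)" by (cases p)
    have "l \<noteq> 0" using jnf that p by (force simp: jordan_nf_def)
    have "[:- b, 1:] ^ l dvd char_poly U"
      unfolding jordan_nf_char_poly[OF jnf] using that p by (auto dest!: split_list)
    then have "poly (char_poly U) b = 0"
      using \<open>l \<noteq> 0\<close> by (metis dvd_power dvd_trans poly_eq_0_iff_dvd gr0I)
    moreover have "char_poly U = (\<Prod>b\<leftarrow>diag_mat U. [:- b, 1:])"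
      by (rule char_poly_upper_triangular[OF U tri])
    ultimately have "b \<in> set (diag_mat U)"
      by (auto simp: poly_prod_list prod_list_zero_iff o_def)
    then have "b = a" using diag U by (auto simp: diag_mat_def)
    then show ?thesis using p by simp
  qed
  then have J: "jordan_matrix n_as = diag_block_mat (map (\<lambda>k. jordan_block k a) (map fst n_as))"
    unfolding jordan_matrix_def by (auto intro!: arg_cong[of _ _ diag_block_mat])
  let ?J = "jordan_matrix n_as"
  have JU: "similar_mat U ?J" using jnf by (simp add: jordan_nf_def)
  then have Jc: "?J \<in> carrier_mat k k"
    using similar_mat_carrier[OF _ U] by blast
  have "similar_mat (four_block_mat U (0\<^sub>m k m) (0\<^sub>m m k) B)
      (four_block_mat ?J (0\<^sub>m k m) (0\<^sub>m m k) B)"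
    by (rule similar_mat_four_block_0_0[OF JU similar_mat_refl[OF B] U B])
  also have "four_block_mat ?J (0\<^sub>m k m) (0\<^sub>m m k) B =
      diag_block_mat (map (\<lambda>k. jordan_block k a) (map fst n_as) @ [B])"
    unfolding diag_block_mat_last using Jc B J by (simp add: Let_def)
  finally have "similar_mat A (diag_block_mat (map (\<lambda>k. jordan_block k a) (map fst n_as) @ [B]))"
    using sim similar_mat_trans by blast
  moreover have "0 \<notin> set (map fst n_as)" using jnf by (simp add: jordan_nf_def)
  ultimately show ?thesis using B ev unfolding jordan_blocks_at_def by blast
qed

text \<open>The orbit count below holds for every list of block sizes, so it applies to whichever
  one the choice operator selects.\<close>

lemma jordan_partition_eq:
  fixes A :: "'a::field mat"
  assumes "A \<in> carrier_mat n n"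
  obtains ks where "jordan_partition A a = mset ks" "jordan_blocks_at A a ks"
proof -
  have "\<exists>\<mu> ks. \<mu> = mset ks \<and> jordan_blocks_at A a ks"
    using ex_jordan_blocks_at[OF assms] by blast
  from someI_ex[OF this] show ?thesis using that unfolding jordan_partition_def by blast
qed

section \<open>Sizes of the kernels of powers of \<open>1 - A\<close>\<close>

lemma card_carrier_vec: "card (carrier_vec n :: 'a::finite vec set) = card (UNIV :: 'a set) ^ n"
proof -
  have "bij_betw list_of_vec (carrier_vec n) {xs :: 'a list. set xs \<subseteq> UNIV \<and> length xs = n}"
    by (rule bij_betwI[where g = vec_of_list]) (auto simp: vec_list list_vec intro!: carrier_vecI)
  then show ?thesis
    using card_lists_length_eq[of "UNIV :: 'a set" n] by (simp add: bij_betw_same_card)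
qed

lemma finite_carrier_vec [simp]: "finite (carrier_vec n :: 'a::finite vec set)"
proof (rule card_ge_0_finite)
  show "card (carrier_vec n :: 'a vec set) > 0"
    by (simp add: card_carrier_vec finite_UNIV_card_ge_0)
qed

text \<open>The map \<open>1 - A\<close>, kept as a function on vectors so that its iterates match
  those of \<open>N\<close>.\<close>

definition displacement :: "'a::field mat \<Rightarrow> 'a vec \<Rightarrow> 'a vec" where
  "displacement A v = v - A *\<^sub>v v"

definition disp_kernel :: "'a::field mat \<Rightarrow> nat \<Rightarrow> 'a vec set" where
  "disp_kernel A i = {v \<in> carrier_vec (dim_row A). (displacement A ^^ i) v = 0\<^sub>v (dim_row A)}"

lemma displacement_carrier:
  "A \<in> carrier_mat n n \<Longrightarrow> v \<in> carrier_vec n \<Longrightarrow> displacement A v \<in> carrier_vec n"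
  by (simp add: displacement_def)

lemma displacement_pow_carrier:
  "A \<in> carrier_mat n n \<Longrightarrow> v \<in> carrier_vec n \<Longrightarrow> (displacement A ^^ i) v \<in> carrier_vec n"
  by (induction i) (simp_all add: displacement_carrier)

lemma displacement_intertwine:
  assumes "A \<in> carrier_mat n n" "J \<in> carrier_mat n n" "P \<in> carrier_mat n n" "A * P = P * J"
    and "v \<in> carrier_vec n"
  shows "(displacement A ^^ i) (P *\<^sub>v v) = P *\<^sub>v ((displacement J ^^ i) v)"
proof (induction i)
  case (Suc i)
  let ?w = "(displacement J ^^ i) v"
  have w: "?w \<in> carrier_vec n" using assms by (intro displacement_pow_carrier)
  have "A *\<^sub>v (P *\<^sub>v ?w) = P *\<^sub>v (J *\<^sub>v ?w)"
  proof -
    have "A *\<^sub>v (P *\<^sub>v ?w) = A * P *\<^sub>v ?w"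
      using assms w by (intro assoc_mult_mat_vec[symmetric])
    also have "\<dots> = P *\<^sub>v (J *\<^sub>v ?w)"
      unfolding assms(4) using assms w by (intro assoc_mult_mat_vec)
    finally show ?thesis .
  qed
  then have "displacement A (P *\<^sub>v ?w) = P *\<^sub>v displacement J ?w"
    using assms w
    by (simp add: displacement_def[of A "P *\<^sub>v ?w"] displacement_def[of J ?w]
        mult_minus_distrib_mat_vec[of P n n])
  then show ?case using Suc by simp
qed simp

lemma card_disp_kernel_similar:
  assumes sim: "similar_mat A J" and A: "A \<in> carrier_mat n n"
  shows "card (disp_kernel A i) = card (disp_kernel J i)"
proof -
  obtain P Q where "similar_mat_wit A J P Q" using sim by (auto simp: similar_mat_def)
  note w = similar_mat_witD2[OF A this]
  have AP: "A * P = P * J"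
  proof -
    have "A * P = P * J * (Q * P)" unfolding w(3) using w by (intro assoc_mult_mat) auto
    then show ?thesis using w by simp
  qed
  have QA: "J * Q = Q * A"
  proof -
    have "Q * A = Q * (P * (J * Q))" unfolding w(3) using w by (simp add: assoc_mult_mat[of P n n J n Q n])
    also have "\<dots> = Q * P * (J * Q)" using w by (intro assoc_mult_mat[symmetric]) auto
    finally show ?thesis using w by simp
  qed
  have id: "P *\<^sub>v (Q *\<^sub>v v) = v" "Q *\<^sub>v (P *\<^sub>v v) = v" if "v \<in> carrier_vec n" for v
    using that w by (simp_all add: assoc_mult_mat_vec[symmetric, of _ n n _ n])
  have zero: "P *\<^sub>v 0\<^sub>v n = 0\<^sub>v n" "Q *\<^sub>v 0\<^sub>v n = 0\<^sub>v n"
    using w by auto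
  have "bij_betw (\<lambda>v. P *\<^sub>v v) (disp_kernel J i) (disp_kernel A i)"
    using w id zero displacement_intertwine[OF w(4,5,6) AP, of _ i]
      displacement_intertwine[OF w(5,4,7) QA, of _ i]
    by (intro bij_betwI[where g = "\<lambda>v. Q *\<^sub>v v"]) (auto simp: disp_kernel_def)
  then show ?thesis by (simp add: bij_betw_same_card)
qed

lemma displacement_four_block:
  assumes "A \<in> carrier_mat n n" "D \<in> carrier_mat m m" "v \<in> carrier_vec n" "w \<in> carrier_vec m"
  shows "(displacement (four_block_mat A (0\<^sub>m n m) (0\<^sub>m m n) D) ^^ i) (v @\<^sub>v w) =
    (displacement A ^^ i) v @\<^sub>v (displacement D ^^ i) w"
proof (induction i)
  case (Suc i)
  let ?v = "(displacement A ^^ i) v" and ?w = "(displacement D ^^ i) w"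
  have c: "?v \<in> carrier_vec n" "?w \<in> carrier_vec m"
    using assms by (auto intro: displacement_pow_carrier)
  have "(?v @\<^sub>v ?w) - (A *\<^sub>v ?v @\<^sub>v D *\<^sub>v ?w) = (?v - A *\<^sub>v ?v) @\<^sub>v (?w - D *\<^sub>v ?w)"
    using c assms by (intro eq_vecI) auto
  then show ?case
    using Suc mult_mat_vec_split[OF assms(1,2) c]
    by (simp add: displacement_def[of _ ?v] displacement_def[of _ ?w] displacement_def[of _ "?v @\<^sub>v ?w"])
qed simp

lemma card_disp_kernel_four_block:
  assumes A: "A \<in> carrier_mat n n" and D: "D \<in> carrier_mat m m"
  shows "card (disp_kernel (four_block_mat A (0\<^sub>m n m) (0\<^sub>m m n) D) i) =
    card (disp_kernel A i) * card (disp_kernel D i)"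
proof -
  let ?F = "four_block_mat A (0\<^sub>m n m) (0\<^sub>m m n) D"
  have zero: "0\<^sub>v (n + m) = (0\<^sub>v n @\<^sub>v 0\<^sub>v m :: 'a vec)" by (intro eq_vecI) auto
  have "disp_kernel ?F i = (\<lambda>(v, w). v @\<^sub>v w) ` (disp_kernel A i \<times> disp_kernel D i)"
  proof (intro equalityI subsetI)
    fix x assume x: "x \<in> disp_kernel ?F i"
    then have xc: "x \<in> carrier_vec (n + m)" using A D by (simp add: disp_kernel_def)
    define v w where "v = vec_first x n" and "w = vec_last x m"
    have vw: "x = v @\<^sub>v w" "v \<in> carrier_vec n" "w \<in> carrier_vec m"
      using xc by (simp_all add: v_def w_def)
    have "(displacement A ^^ i) v @\<^sub>v (displacement D ^^ i) w = 0\<^sub>v n @\<^sub>v 0\<^sub>v m"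
      using x A D vw displacement_four_block[OF A D vw(2,3)] by (simp add: disp_kernel_def zero)
    then have "(displacement A ^^ i) v = 0\<^sub>v n \<and> (displacement D ^^ i) w = 0\<^sub>v m"
      using displacement_pow_carrier[OF A vw(2)] by (subst (asm) append_vec_eq) auto
    then show "x \<in> (\<lambda>(v, w). v @\<^sub>v w) ` (disp_kernel A i \<times> disp_kernel D i)"
      using A D vw by (auto simp: disp_kernel_def)
  next
    fix x assume "x \<in> (\<lambda>(v, w). v @\<^sub>v w) ` (disp_kernel A i \<times> disp_kernel D i)"
    then obtain v w where "x = v @\<^sub>v w" "v \<in> carrier_vec n" "w \<in> carrier_vec m"
      "(displacement A ^^ i) v = 0\<^sub>v n" "(displacement D ^^ i) w = 0\<^sub>v m"
      using A D by (auto simp: disp_kernel_def)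
    then show "x \<in> disp_kernel ?F i"
      using A D displacement_four_block[OF A D] by (auto simp: disp_kernel_def zero)
  qed
  moreover have "inj_on (\<lambda>(v, w). v @\<^sub>v w) (disp_kernel A i \<times> disp_kernel D i)"
    using A by (auto simp: inj_on_def disp_kernel_def append_vec_eq[of _ n])
  ultimately show ?thesis by (simp add: card_image card_cartesian_product)
qed

text \<open>For a Jordan block with eigenvalue 1, \<open>1 - J\<close> is the negative of the shift
  \<open>v $ j |-> v $ (j + 1)\<close>.\<close>

lemma displacement_jordan_block:
  assumes "v \<in> carrier_vec k" "j < k"
  shows "(displacement (jordan_block k 1) ^^ i) v $ j = (if j + i < k then (-1) ^ i * v $ (j + i) else 0)"
  using assms(2)
proof (induction i arbitrary: j)
  case (Suc i)
  let ?w = "(displacement (jordan_block k 1) ^^ i) v"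
  have w: "?w \<in> carrier_vec k"
    using assms(1) by (intro displacement_pow_carrier) auto
  have "(jordan_block k 1 *\<^sub>v ?w) $ j = (\<Sum>l\<in>{0..<k}. jordan_block k 1 $$ (j, l) * ?w $ l)"
    using Suc.prems w by (auto simp: scalar_prod_def intro!: sum.cong)
  also have "\<dots> = (\<Sum>l\<in>{0..<k}. (if l = j then ?w $ l else 0) + (if l = Suc j then ?w $ l else 0))"
    using Suc.prems by (intro sum.cong) auto
  also have "\<dots> = ?w $ j + (if Suc j < k then ?w $ Suc j else 0)"
    using Suc.prems by (simp add: sum.distrib)
  finally have "displacement (jordan_block k 1) ?w $ j = - (if Suc j < k then ?w $ Suc j else 0)"
    using Suc.prems w by (simp add: displacement_def)
  then show ?case using Suc.IH[of "Suc j"] by auto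
qed (use assms in auto)

text \<open>The kernel consists of the vectors supported on the first \<open>min i k\<close>
  coordinates.\<close>

lemma card_disp_kernel_jordan_block:
  "card (disp_kernel (jordan_block k (1 :: 'a::{field,finite})) i) = card (UNIV :: 'a set) ^ min i k"
proof -
  let ?J = "jordan_block k (1 :: 'a)" and ?m = "min i k"
  have "v \<in> disp_kernel ?J i \<longleftrightarrow> v \<in> carrier_vec k \<and> (\<forall>j<k. i \<le> j \<longrightarrow> v $ j = 0)" for v
  proof (cases "v \<in> carrier_vec k")
    case True
    have "(displacement ?J ^^ i) v = 0\<^sub>v k \<longleftrightarrow> (\<forall>j<k. (displacement ?J ^^ i) v $ j = 0)"
      using displacement_pow_carrier[of ?J k v i] True by (auto simp: vec_eq_iff)
    also have "\<dots> \<longleftrightarrow> (\<forall>j<k. j + i < k \<longrightarrow> v $ (j + i) = 0)"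
      by (auto simp: displacement_jordan_block[OF True])
    also have "\<dots> \<longleftrightarrow> (\<forall>j<k. i \<le> j \<longrightarrow> v $ j = 0)"
      by (metis add.commute add_leD1 le_add1 le_Suc_ex le_less_trans)
    finally show ?thesis using True by (simp add: disp_kernel_def)
  qed (simp add: disp_kernel_def)
  then have "bij_betw (\<lambda>w. vec k (\<lambda>j. if j < ?m then w $ j else 0)) (carrier_vec ?m) (disp_kernel ?J i)"
    by (intro bij_betwI[where g = "\<lambda>v. vec ?m (\<lambda>j. v $ j)"]) (auto intro!: eq_vecI)
  then show ?thesis using card_carrier_vec[of ?m, where 'a = 'a] by (simp add: bij_betw_same_card)
qed

lemma card_disp_kernel_no_eigenvalue:
  fixes B :: "'a::field mat"
  assumes B: "B \<in> carrier_mat m m" and ev: "\<not> eigenvalue B 1"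
  shows "card (disp_kernel B i) = 1"
proof -
  have inj: "v = 0\<^sub>v m" if "v \<in> carrier_vec m" "displacement B v = 0\<^sub>v m" for v
  proof (rule ccontr)
    assume "v \<noteq> 0\<^sub>v m"
    moreover have "B *\<^sub>v v = v"
    proof (rule eq_vecI)
      fix j assume j: "j < dim_vec v"
      then have "(v - B *\<^sub>v v) $ j = 0" using that by (simp add: displacement_def)
      then show "(B *\<^sub>v v) $ j = v $ j" using j that B by simp
    qed (use that B in auto)
    ultimately show False
      using ev that B by (auto simp: eigenvalue_def eigenvector_def)
  qed
  have "v = 0\<^sub>v m" if "v \<in> carrier_vec m" "(displacement B ^^ i) v = 0\<^sub>v m" for v
    using that
  proof (induction i arbitrary: v)
    case (Suc i)
    then have "(displacement B ^^ i) (displacement B v) = 0\<^sub>v m"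
      by (simp del: funpow.simps add: funpow_Suc_right)
    then have "displacement B v = 0\<^sub>v m"
      by (rule Suc.IH[OF displacement_carrier[OF B Suc.prems(1)]])
    then show ?case using inj Suc.prems by blast
  qed simp
  moreover have "(displacement B ^^ i) (0\<^sub>v m) = 0\<^sub>v m"
  proof (induction i)
    case (Suc i)
    have "displacement B (0\<^sub>v m) = 0\<^sub>v m"
      using B by (auto simp: displacement_def)
    then show ?case using Suc by simp
  qed simp
  ultimately have "disp_kernel B i = {0\<^sub>v m}"
    using B by (auto simp: disp_kernel_def)
  then show ?thesis by simp
qed

lemma diag_block_mat_carrier:
  assumes "\<And>A. A \<in> set As \<Longrightarrow> square_mat A"
  shows "diag_block_mat As \<in> carrier_mat (dim_row (diag_block_mat As)) (dim_row (diag_block_mat As))"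
proof -
  have "square_mat (diag_block_mat As)"
    using assms by (intro diag_block_mat_square) blast
  then show ?thesis by (intro carrier_matI) simp_all
qed

lemma card_disp_kernel_jordan_blocks:
  fixes A :: "'a::{field,finite} mat"
  assumes A: "A \<in> carrier_mat n n" and ks: "jordan_blocks_at A 1 ks"
  shows "card (disp_kernel A i) = card (UNIV :: 'a set) ^ (\<Sum>k\<leftarrow>ks. min i k)"
proof -
  obtain m B where B: "B \<in> carrier_mat m m" "\<not> eigenvalue B 1"
    and sim: "similar_mat A (diag_block_mat (map (\<lambda>k. jordan_block k 1) ks @ [B]))"
    using ks by (auto simp: jordan_blocks_at_def)
  have "card (disp_kernel (diag_block_mat (map (\<lambda>k. jordan_block k 1) ks @ [B])) i) =
      card (UNIV :: 'a set) ^ (\<Sum>k\<leftarrow>ks. min i k)"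
  proof (induction ks)
    case Nil
    then show ?case using card_disp_kernel_no_eigenvalue[OF B] by (simp del: diag_block_mat.simps)
  next
    case (Cons k ks)
    let ?D = "diag_block_mat (map (\<lambda>k. jordan_block k (1 :: 'a)) ks @ [B])"
    have D: "?D \<in> carrier_mat (dim_row ?D) (dim_row ?D)"
      using B by (intro diag_block_mat_carrier) auto
    then have "dim_col ?D = dim_row ?D" by (rule carrier_matD(2))
    then show ?case
      using Cons card_disp_kernel_four_block[OF jordan_block_carrier[of k 1] D, of i]
      by (simp add: Let_def card_disp_kernel_jordan_block power_add)
  qed
  then show ?thesis using card_disp_kernel_similar[OF sim A] by simp
qed

text \<open>As a function of \<open>i\<close>, \<open>min i k\<close> has second difference -1 at
  \<open>i = k\<close> and 0 at other positive \<open>i\<close>. So kernel dimensions determine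
  multiplicities.\<close>

lemma sum_list_min_count:
  assumes "i > 0"
  shows "2 * (\<Sum>k\<leftarrow>ks. min i k) = (\<Sum>k\<leftarrow>ks. min (i - 1) k) + (\<Sum>k\<leftarrow>ks. min (Suc i) k) + count (mset ks) i"
  using assms by (induction ks) auto

hide_const (open) UnivPoly.coeff UnivPoly.monom

text \<open>
  Put \<open>N = 1 - g\<close> and \<open>K i = ker (N^i)\<close>. Every coset of \<open>N V\<close> has a representative \<open>u\<close> in some \<open>K i\<close>;
  take \<open>i\<close> minimal. On \<open>K i\<close> the form \<open>B (u, v) = f (u, N^(i-1) v)\<close> is hermitian up to sign, its radical
  is \<open>K i \<inter> (K (i-1) + N V)\<close>, and the quotient by the radical has dimension the number \<open>m\<close> of Jordan
  blocks of size \<open>i\<close>. The pair of \<open>i\<close> and \<open>B (u, u)\<close> depends only on the orbit of the coset.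
  Conversely let \<open>u, w\<close> have the same \<open>i\<close> and the same value \<open>B (u, u) = B (w, w)\<close>. After changing
  \<open>w\<close> modulo \<open>N V\<close>, also \<open>f (u, N^j u) = f (w, N^j w)\<close> for all \<open>j\<close>. If \<open>B (u, u - w) \<noteq> 0\<close>, then \<open>V\<close> is
  the direct sum of the cyclic subspace of \<open>u\<close> and the orthogonal complement of the cyclic subspace of
  \<open>u - w\<close>, and the map sending \<open>p(N) u\<close> to \<open>p(N) w\<close> and fixing that complement is an isometry commuting
  with \<open>g\<close>. Otherwise one first multiplies \<open>w\<close> by a scalar of norm one, or passes through a third,
  isotropic vector. Finally, the values of \<open>B (u, u)\<close> range over a set of \<open>q\<close> elements, from which
  \<open>0\<close> has to be omitted exactly if \<open>m = 1\<close>.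
\<close>

section \<open>Orbits of the centralizer\<close>

lemma invertible_mat_obtain:
  assumes "A \<in> carrier_mat n n" "invertible_mat A"
  obtains B where "B \<in> carrier_mat n n" "A * B = 1\<^sub>m n" "B * A = 1\<^sub>m n"
proof -
  obtain B where B: "A * B = 1\<^sub>m (dim_row A)" "B * A = 1\<^sub>m (dim_row B)"
    using assms(2) by (auto simp: invertible_mat_def inverts_mat_def)
  have "dim_col B = n" using arg_cong[OF B(1), of dim_col] assms(1) by simp
  moreover have "dim_row B = n" using arg_cong[OF B(2), of dim_col] assms(1) by simp
  ultimately show ?thesis using B assms(1) by (intro that[of B]) auto
qed

lemma invertible_matI:
  assumes "A \<in> carrier_mat n n" "B \<in> carrier_mat n n" "A * B = 1\<^sub>m n" "B * A = 1\<^sub>m n"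
  shows "invertible_mat A"
  using assms by (auto simp: invertible_mat_def inverts_mat_def)

lemma mult_inverses:
  fixes A B :: "'a::semiring_1 mat"
  assumes "A \<in> carrier_mat n n" "B \<in> carrier_mat n n" "A' \<in> carrier_mat n n" "B' \<in> carrier_mat n n"
    and "A * A' = 1\<^sub>m n" "B * B' = 1\<^sub>m n"
  shows "A * B * (B' * A') = 1\<^sub>m n"
proof -
  have "B * (B' * A') = B * B' * A'"
    using assms by (intro assoc_mult_mat[symmetric])
  also have "\<dots> = A'" using assms by simp
  finally show ?thesis
    using assms by (simp add: assoc_mult_mat[of A n n B n "B' * A'" n])
qed

lemma unitary_group_carrier:
  "h \<in> carrier (unitary_group n f) \<longleftrightarrow> h \<in> carrier_mat n n \<and> invertible_mat h \<and>
    (\<forall>v\<in>carrier_vec n. \<forall>w\<in>carrier_vec n. f (h *\<^sub>v v) (h *\<^sub>v w) = f v w)"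
  by (simp add: unitary_group_def)

lemma unitary_group_inverse:
  assumes h: "h \<in> carrier (unitary_group n f)"
  obtains k where "k \<in> carrier (unitary_group n f)" "h * k = 1\<^sub>m n" "k * h = 1\<^sub>m n"
proof -
  have hc: "h \<in> carrier_mat n n" and inv: "invertible_mat h"
    and iso: "\<And>v w. v \<in> carrier_vec n \<Longrightarrow> w \<in> carrier_vec n \<Longrightarrow> f (h *\<^sub>v v) (h *\<^sub>v w) = f v w"
    using h by (auto simp: unitary_group_carrier)
  obtain k where k: "k \<in> carrier_mat n n" "h * k = 1\<^sub>m n" "k * h = 1\<^sub>m n"
    using invertible_mat_obtain[OF hc inv] by blast
  have hk: "h *\<^sub>v (k *\<^sub>v v) = v" if "v \<in> carrier_vec n" for v
    using that hc k by (simp add: assoc_mult_mat_vec[symmetric, of _ n n _ n])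
  have "f (k *\<^sub>v v) (k *\<^sub>v w) = f v w" if "v \<in> carrier_vec n" "w \<in> carrier_vec n" for v w
    using that iso[of "k *\<^sub>v v" "k *\<^sub>v w"] hk k by simp
  then have "k \<in> carrier (unitary_group n f)"
    using invertible_matI[OF k(1) hc k(3,2)] k by (simp add: unitary_group_carrier)
  then show ?thesis using k that by blast
qed

lemma group_unitary_group: "group (unitary_group n f)"
proof (rule groupI)
  fix h k assume hk: "h \<in> carrier (unitary_group n f)" "k \<in> carrier (unitary_group n f)"
  then have c: "h \<in> carrier_mat n n" "k \<in> carrier_mat n n" by (auto simp: unitary_group_carrier)
  obtain h' k' where h': "h' \<in> carrier_mat n n" "h * h' = 1\<^sub>m n" "h' * h = 1\<^sub>m n"
    and k': "k' \<in> carrier_mat n n" "k * k' = 1\<^sub>m n" "k' * k = 1\<^sub>m n"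
    using invertible_mat_obtain c hk by (metis unitary_group_carrier)
  have "h * k * (k' * h') = 1\<^sub>m n" "k' * h' * (h * k) = 1\<^sub>m n"
    using c h' k' by (auto intro: mult_inverses)
  then have "invertible_mat (h * k)"
    using c h' k' by (intro invertible_matI[of _ n "k' * h'"]) auto
  moreover have "f (h * k *\<^sub>v v) (h * k *\<^sub>v w) = f v w" if "v \<in> carrier_vec n" "w \<in> carrier_vec n" for v w
    using that c hk by (simp add: assoc_mult_mat_vec[of _ n n _ n] unitary_group_carrier)
  ultimately have "h * k \<in> carrier (unitary_group n f)"
    using c by (simp add: unitary_group_carrier)
  then show "h \<otimes>\<^bsub>unitary_group n f\<^esub> k \<in> carrier (unitary_group n f)"
    by (simp add: unitary_group_def)
next
  have "invertible_mat (1\<^sub>m n :: 'a mat)" by (intro invertible_matI[of _ n "1\<^sub>m n"]) auto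
  then show "\<one>\<^bsub>unitary_group n f\<^esub> \<in> carrier (unitary_group n f)"
    by (simp add: unitary_group_def)
next
  fix h k l
  assume "h \<in> carrier (unitary_group n f)" "k \<in> carrier (unitary_group n f)" "l \<in> carrier (unitary_group n f)"
  then show "h \<otimes>\<^bsub>unitary_group n f\<^esub> k \<otimes>\<^bsub>unitary_group n f\<^esub> l =
      h \<otimes>\<^bsub>unitary_group n f\<^esub> (k \<otimes>\<^bsub>unitary_group n f\<^esub> l)"
    by (simp add: unitary_group_def assoc_mult_mat[of h n n k n l n])
next
  fix h assume h: "h \<in> carrier (unitary_group n f)"
  then show "\<one>\<^bsub>unitary_group n f\<^esub> \<otimes>\<^bsub>unitary_group n f\<^esub> h = h"
    by (auto simp: unitary_group_def)
  obtain k where "k \<in> carrier (unitary_group n f)" "k * h = 1\<^sub>m n"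
    using h by (rule unitary_group_inverse)
  then show "\<exists>k\<in>carrier (unitary_group n f). k \<otimes>\<^bsub>unitary_group n f\<^esub> h = \<one>\<^bsub>unitary_group n f\<^esub>"
    by (intro bexI[of _ k]) (simp_all add: unitary_group_def)
qed

lemma conjugacy_class_carrier:
  assumes "group G" "C \<in> conjugacy_classes G" "g \<in> C"
  shows "g \<in> carrier G"
proof -
  interpret group G by fact
  show ?thesis using assms(2,3) by (auto simp: conjugacy_classes_def)
qed

lemma card_image_cong_fibres:
  assumes "\<And>x y. x \<in> A \<Longrightarrow> y \<in> A \<Longrightarrow> F x = F y \<longleftrightarrow> G x = G y"
  shows "card (F ` A) = card (G ` A)"
proof -
  have "F (inv_into A G (G x)) = F x" if "x \<in> A" for x
    using that assms[of "inv_into A G (G x)" x] by (simp add: inv_into_into f_inv_into_f)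
  moreover have "G (inv_into A F (F x)) = G x" if "x \<in> A" for x
    using that assms[of "inv_into A F (F x)" x] by (simp add: inv_into_into f_inv_into_f)
  ultimately have "bij_betw (\<lambda>y. G (inv_into A F y)) (F ` A) (G ` A)"
    by (intro bij_betwI[where g = "\<lambda>y. F (inv_into A G y)"])
      (auto simp: inv_into_into f_inv_into_f assms)
  then show ?thesis by (rule bij_betw_same_card)
qed

section \<open>Vectors encoded as polynomials\<close>

text \<open>
  Vectors of length \<open>n\<close> are encoded as polynomials of degree less than \<open>n\<close>, because these form a
  subspace of a type of class \<open>ab_group_add\<close>, which the type of vectors of all lengths is not.
\<close>

definition poly_of :: "'a::zero vec \<Rightarrow> 'a poly" where
  "poly_of v = Poly (list_of_vec v)"

definition vec_of :: "nat \<Rightarrow> 'a::zero poly \<Rightarrow> 'a vec" where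
  "vec_of n p = vec n (coeff p)"

definition poly_space :: "nat \<Rightarrow> 'a::zero poly set" where
  "poly_space n = {p. \<forall>i\<ge>n. coeff p i = 0}"

lemma coeff_poly_of: "coeff (poly_of v) i = (if i < dim_vec v then v $ i else 0)"
  by (simp add: poly_of_def nth_default_def list_of_vec_index)

lemma vec_of_carrier [simp]: "vec_of n p \<in> carrier_vec n"
  by (simp add: vec_of_def)

lemma vec_of_poly_of [simp]: "v \<in> carrier_vec n \<Longrightarrow> vec_of n (poly_of v) = v"
  by (intro eq_vecI) (auto simp: vec_of_def coeff_poly_of)

lemma poly_of_space [simp]: "v \<in> carrier_vec n \<Longrightarrow> poly_of v \<in> poly_space n"
  by (auto simp: poly_space_def coeff_poly_of)

lemma poly_of_vec_of [simp]: "p \<in> poly_space n \<Longrightarrow> poly_of (vec_of n p) = p"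
  by (intro poly_eqI) (auto simp: poly_space_def coeff_poly_of vec_of_def)

lemma poly_space_eq: "poly_space n = poly_of ` carrier_vec n"
proof (intro equalityI subsetI)
  fix p :: "'a poly" assume "p \<in> poly_space n"
  then have "p = poly_of (vec_of n p)" by simp
  then show "p \<in> poly_of ` carrier_vec n" using vec_of_carrier by blast
qed auto

lemma ball_poly_space: "(\<forall>p\<in>poly_space n. P p) \<longleftrightarrow> (\<forall>v\<in>carrier_vec n. P (poly_of v))"
  by (simp add: poly_space_eq)

lemma poly_of_inject:
  "v \<in> carrier_vec n \<Longrightarrow> w \<in> carrier_vec n \<Longrightarrow> poly_of v = poly_of w \<longleftrightarrow> v = w"
  by (metis vec_of_poly_of)

lemma vec_of_simps:
  "vec_of n (p + r) = vec_of n p + vec_of n r" "vec_of n (Polynomial.smult c p) = c \<cdot>\<^sub>v vec_of n p"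
  "vec_of n (p - r) = vec_of n p - vec_of n (r :: 'a::comm_ring_1 poly)"
  by (auto simp: vec_of_def intro!: eq_vecI)

lemma poly_of_simps:
  "v \<in> carrier_vec n \<Longrightarrow> w \<in> carrier_vec n \<Longrightarrow> poly_of (v + w) = poly_of v + poly_of w"
  "v \<in> carrier_vec n \<Longrightarrow> w \<in> carrier_vec n \<Longrightarrow> poly_of (v - w) = poly_of v - poly_of (w :: 'a::comm_ring_1 vec)"
  "poly_of (c \<cdot>\<^sub>v v) = Polynomial.smult c (poly_of v)"
  by (intro poly_eqI; simp add: coeff_poly_of)+

lemma poly_of_zero [simp]: "poly_of (0\<^sub>v n) = 0"
  by (intro poly_eqI) (simp add: coeff_poly_of)

section \<open>From a unitary matrix to a hermitian space\<close>

locale unitary_element = quadratic_field q "TYPE('a)"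
  for q :: nat and n :: nat and f :: "'a::{field,finite} vec \<Rightarrow> 'a vec \<Rightarrow> 'a" and g :: "'a mat" +
  assumes hermitian: "hermitian_form q n f" and nondegenerate: "nondegenerate_form n f"
    and g: "g \<in> carrier (unitary_group n f)"
begin

lemma g_carrier: "g \<in> carrier_mat n n"
  using g by (simp add: unitary_group_carrier)

lemma disp_carrier: "v \<in> carrier_vec n \<Longrightarrow> displacement g v \<in> carrier_vec n"
  by (rule displacement_carrier[OF g_carrier])

text \<open>Truncation by \<open>vec_of n\<close> makes the laws of the form hold for all
  polynomials, as the ambient type in \<open>hermitian_space\<close> requires.\<close>

definition form :: "'a poly \<Rightarrow> 'a poly \<Rightarrow> 'a" where
  "form p r = f (vec_of n p) (vec_of n r)"

definition disp :: "'a poly \<Rightarrow> 'a poly" where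
  "disp p = poly_of (displacement g (vec_of n p))"

lemma disp_poly_of: "v \<in> carrier_vec n \<Longrightarrow> disp (poly_of v) = poly_of (displacement g v)"
  by (simp add: disp_def)

lemma form_poly_of: "v \<in> carrier_vec n \<Longrightarrow> w \<in> carrier_vec n \<Longrightarrow> form (poly_of v) (poly_of w) = f v w"
  by (simp add: form_def)

lemma disp_linear: "v \<in> carrier_vec n \<Longrightarrow> w \<in> carrier_vec n \<Longrightarrow>
    displacement g (v + w) = displacement g v + displacement g w"
  "v \<in> carrier_vec n \<Longrightarrow> displacement g (c \<cdot>\<^sub>v v) = c \<cdot>\<^sub>v displacement g v"
  using g_carrier unfolding displacement_def
  by (auto simp: mult_add_distrib_mat_vec[OF g_carrier] mult_mat_vec[OF g_carrier] algebra_simps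
      intro!: eq_vecI)

sublocale S: hermitian_space Polynomial.smult q "poly_space n" form disp
proof
  have add: "f (u + v) w = f u w + f v w"
    if "u \<in> carrier_vec n" "v \<in> carrier_vec n" "w \<in> carrier_vec n" for u v w
    using hermitian that unfolding hermitian_form_def by blast
  have scale: "f (c \<cdot>\<^sub>v v) w = c * f v w" and herm: "f w v = f v w ^ q"
    if "v \<in> carrier_vec n" "w \<in> carrier_vec n" for v w c
    using hermitian that unfolding hermitian_form_def by blast+
  show "form (x + y) z = form x z + form y z" for x y z
    unfolding form_def vec_of_simps by (intro add) simp_all
  show "form (Polynomial.smult c x) y = c * form x y" for x y c
    unfolding form_def vec_of_simps by (intro scale) simp_all
  show "form y x = form x y ^ q" for x y
    unfolding form_def by (intro herm) simp_all
  interpret vs: vector_space "Polynomial.smult :: 'a \<Rightarrow> _"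
    by unfold_locales (auto simp: smult_add_right smult_add_left)
  show "vs.subspace (poly_space n)"
    by (rule vs.subspaceI) (auto simp: poly_space_def)
  show "finite (poly_space n :: 'a poly set)"
    by (simp add: poly_space_eq)
  show "x = 0" if x: "x \<in> poly_space n" and orth: "\<And>y. y \<in> poly_space n \<Longrightarrow> form x y = 0" for x
  proof -
    obtain v where v: "v \<in> carrier_vec n" "x = poly_of v"
      using x by (auto simp: poly_space_eq)
    have "f v w = 0" if "w \<in> carrier_vec n" for w
      using orth[of "poly_of w"] that v form_poly_of by simp
    then have "v = 0\<^sub>v n" using nondegenerate v(1) by (simp add: nondegenerate_form_def)
    then show ?thesis using v by simp
  qed
  show "disp (x + y) = disp x + disp y" "disp (Polynomial.smult c x) = Polynomial.smult c (disp x)" for x y c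
    by (simp_all add: disp_def vec_of_simps disp_linear poly_of_simps(3)
        poly_of_simps(1)[OF disp_carrier disp_carrier])
  show "disp x \<in> poly_space n" for x
    by (simp add: disp_def disp_carrier)
  show "form (x - disp x) (y - disp y) = form x y" for x y
  proof -
    have "vec_of n (x - disp x) = g *\<^sub>v vec_of n x" for x
    proof -
      have "vec_of n (x - disp x) = vec_of n x - displacement g (vec_of n x)"
        by (simp add: vec_of_simps disp_def disp_carrier)
      also have "\<dots> = g *\<^sub>v vec_of n x"
        using g_carrier by (intro eq_vecI) (auto simp: displacement_def)
      finally show ?thesis .
    qed
    then show ?thesis
      using g by (simp add: form_def unitary_group_carrier)
  qed
qed (auto simp: smult_add_right smult_add_left)

lemma disp_pow_poly_of:
  "v \<in> carrier_vec n \<Longrightarrow> (disp ^^ i) (poly_of v) = poly_of ((displacement g ^^ i) v)"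
  by (induction i) (simp_all add: disp_poly_of displacement_pow_carrier[OF g_carrier])

lemma K_eq: "S.K i = poly_of ` disp_kernel g i"
proof -
  have "(disp ^^ i) (poly_of v) = 0 \<longleftrightarrow> (displacement g ^^ i) v = 0\<^sub>v n" if "v \<in> carrier_vec n" for v
    using poly_of_inject[OF displacement_pow_carrier[OF g_carrier that], of "0\<^sub>v n"]
    by (simp add: disp_pow_poly_of[OF that])
  moreover have "S.K i = {p \<in> poly_space n. (disp ^^ i) p = 0}" by (rule S.K_def)
  ultimately show ?thesis
    using g_carrier unfolding poly_space_eq disp_kernel_def by auto
qed

lemma card_K: "card (S.K i) = card (disp_kernel g i)"
proof -
  have "inj_on poly_of (disp_kernel g i)"
    using g_carrier by (auto simp: inj_on_def disp_kernel_def poly_of_inject[of _ n])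
  then show ?thesis unfolding K_eq by (rule card_image)
qed

text \<open>\<open>card_rad\<close> expresses the size of \<open>rad i\<close> by three consecutive
  kernels; their exponents combine by \<open>sum_list_min_count\<close>.\<close>

lemma card_K_rad:
  assumes ks: "jordan_blocks_at g 1 ks" and i: "i > 0"
  shows "card (S.K i) = (q ^ 2) ^ count (mset ks) i * card (S.rad i)"
proof -
  let ?s = "\<lambda>i. \<Sum>k\<leftarrow>ks. min i k" and ?m = "count (mset ks) i"
  have K: "card (S.K j) = (q ^ 2) ^ ?s j" for j
    using card_disp_kernel_jordan_blocks[OF g_carrier ks] card_K card_field by simp
  have "card (S.K i) * card (S.K i) = (q ^ 2) ^ (2 * ?s i)"
    unfolding K by (simp only: mult_2 power_add)
  also have "\<dots> = (q ^ 2) ^ ?m * (card (S.K (i - 1)) * card (S.K (Suc i)))"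
    unfolding K sum_list_min_count[OF i] by (simp only: power_add mult_ac)
  also have "\<dots> = (q ^ 2) ^ ?m * card (S.rad i) * card (S.K i)"
    using S.card_rad[OF i] by simp
  finally show ?thesis
    using K[of i] q_gt_1 by simp
qed

definition centr :: "'a mat set" where
  "centr = {h \<in> carrier (unitary_group n f). h * g = g * h}"

lemma centr_eq: "centr = centralizer (unitary_group n f) g"
  by (simp add: centr_def centralizer_def unitary_group_def)

lemma centr_carrier: "h \<in> centr \<Longrightarrow> h \<in> carrier_mat n n"
  by (simp add: centr_def unitary_group_carrier)

lemma centr_disp:
  assumes "h \<in> centr" "v \<in> carrier_vec n"
  shows "h *\<^sub>v displacement g v = displacement g (h *\<^sub>v v)"
  using displacement_intertwine[OF g_carrier g_carrier centr_carrier[OF assms(1)] _ assms(2), of 1] assms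
  by (simp add: centr_def)

lemma centr_isometry:
  assumes h: "h \<in> centr"
  shows "(\<lambda>p. poly_of (h *\<^sub>v vec_of n p)) \<in> S.isometries"
proof -
  have hc: "h \<in> carrier_mat n n" by (rule centr_carrier[OF h])
  then have hv: "h *\<^sub>v v \<in> carrier_vec n" if "v \<in> carrier_vec n" for v using that by simp
  show ?thesis
    unfolding S.isometries_def mem_Collect_eq ball_poly_space
  proof (intro conjI ballI allI)
    fix v w :: "'a vec" and c :: 'a assume v: "v \<in> carrier_vec n" and w: "w \<in> carrier_vec n"
    show "poly_of (h *\<^sub>v vec_of n (poly_of v)) \<in> poly_space n"
      using v hv by simp
    show "poly_of (h *\<^sub>v vec_of n (poly_of v + poly_of w)) =
        poly_of (h *\<^sub>v vec_of n (poly_of v)) + poly_of (h *\<^sub>v vec_of n (poly_of w))"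
      using v w hc by (simp add: vec_of_simps mult_add_distrib_mat_vec[OF hc] poly_of_simps(1)[OF hv hv])
    show "poly_of (h *\<^sub>v vec_of n (Polynomial.smult c (poly_of v))) =
        Polynomial.smult c (poly_of (h *\<^sub>v vec_of n (poly_of v)))"
      using v by (simp add: vec_of_simps mult_mat_vec[OF hc] poly_of_simps(3))
    show "form (poly_of (h *\<^sub>v vec_of n (poly_of v))) (poly_of (h *\<^sub>v vec_of n (poly_of w))) =
        form (poly_of v) (poly_of w)"
      using v w h hv by (simp add: form_poly_of centr_def unitary_group_carrier)
    show "poly_of (h *\<^sub>v vec_of n (disp (poly_of v))) = disp (poly_of (h *\<^sub>v vec_of n (poly_of v)))"
      using v hv by (simp add: disp_poly_of disp_carrier centr_disp[OF h])
  qed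
qed

lemma poly_of_expand:
  fixes v :: "'a vec"
  assumes "v \<in> carrier_vec n"
  shows "poly_of v = (\<Sum>j<n. Polynomial.smult (v $ j) (poly_of (unit_vec n j)))"
proof (rule poly_eqI)
  fix i
  have "coeff (\<Sum>j<n. Polynomial.smult (v $ j) (poly_of (unit_vec n j))) i =
      (\<Sum>j<n. if i = j then v $ j else 0)"
    unfolding coeff_sum by (intro sum.cong) (auto simp: coeff_poly_of)
  then show "coeff (poly_of v) i = coeff (\<Sum>j<n. Polynomial.smult (v $ j) (poly_of (unit_vec n j))) i"
    using assms by (simp add: coeff_poly_of)
qed

lemma isometry_sum:
  fixes m :: nat
  assumes h: "h \<in> S.isometries" and p: "\<And>j. p j \<in> poly_space n"
  shows "(\<Sum>j<m. Polynomial.smult (c j) (p j)) \<in> poly_space n \<and>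
    h (\<Sum>j<m. Polynomial.smult (c j) (p j)) = (\<Sum>j<m. Polynomial.smult (c j) (h (p j)))"
proof (induction m)
  case 0
  then show ?case using S.isometries_zero[OF h] S.V_closed(1) by simp
next
  case (Suc m)
  then show ?case
    using S.isometriesD[OF h] p by (simp add: S.V_closed)
qed

text \<open>The columns of \<open>H\<close> are the images of the unit vectors; \<open>H\<close> is
  injective, hence invertible, because it preserves a nondegenerate form.\<close>

lemma isometry_matrix:
  assumes h: "h \<in> S.isometries"
  obtains H where "H \<in> centr" "\<And>v. v \<in> carrier_vec n \<Longrightarrow> poly_of (H *\<^sub>v v) = h (poly_of v)"
proof -
  define H where "H = mat n n (\<lambda>(i, j). coeff (h (poly_of (unit_vec n j))) i)"
  have Hc: "H \<in> carrier_mat n n" by (simp add: H_def)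
  have H: "poly_of (H *\<^sub>v v) = h (poly_of v)" if v: "v \<in> carrier_vec n" for v
  proof -
    have "H *\<^sub>v v = vec_of n (h (poly_of v))"
    proof (rule eq_vecI)
      fix i assume "i < dim_vec (vec_of n (h (poly_of v)))"
      then have i: "i < n" by (simp add: vec_of_def)
      have "h (poly_of v) = (\<Sum>j<n. Polynomial.smult (v $ j) (h (poly_of (unit_vec n j))))"
        unfolding poly_of_expand[OF v] using isometry_sum[OF h, of "\<lambda>j. poly_of (unit_vec n j)"] by simp
      then have "coeff (h (poly_of v)) i = (\<Sum>j<n. v $ j * coeff (h (poly_of (unit_vec n j))) i)"
        by (simp add: coeff_sum)
      also have "\<dots> = (H *\<^sub>v v) $ i"
        using i v by (auto simp: H_def scalar_prod_def atLeast0LessThan mult.commute intro!: sum.cong)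
      finally show "(H *\<^sub>v v) $ i = vec_of n (h (poly_of v)) $ i"
        using i by (simp add: vec_of_def)
    qed (simp add: H_def vec_of_def)
    then show ?thesis using S.isometriesD(1)[OF h] v by simp
  qed
  have iso: "f (H *\<^sub>v v) (H *\<^sub>v w) = f v w" if "v \<in> carrier_vec n" "w \<in> carrier_vec n" for v w
    using S.isometriesD(4)[OF h, of "poly_of v" "poly_of w"] that H Hc
      form_poly_of[of "H *\<^sub>v v" "H *\<^sub>v w"] form_poly_of[of v w] by simp
  have "det H \<noteq> 0"
  proof
    assume "det H = 0"
    then obtain v where v: "v \<in> carrier_vec n" "v \<noteq> 0\<^sub>v n" "H *\<^sub>v v = 0\<^sub>v n"
      using det_0_iff_vec_prod_zero_field[OF Hc] by blast
    have "f v w = 0" if w: "w \<in> carrier_vec n" for w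
    proof -
      have "f v w = f (0\<^sub>v n) (H *\<^sub>v w)" using iso[OF v(1) w] v(3) by simp
      also have "\<dots> = form 0 (poly_of (H *\<^sub>v w))"
        using form_poly_of[of "0\<^sub>v n" "H *\<^sub>v w"] Hc w by simp
      finally show ?thesis by (simp add: S.f_zero)
    qed
    then show False using nondegenerate v by (auto simp: nondegenerate_form_def)
  qed
  from det_non_zero_imp_unit[OF Hc this, of "()"]
  obtain H' where "H' \<in> carrier_mat n n" "H' * H = 1\<^sub>m n" "H * H' = 1\<^sub>m n"
    unfolding Units_def ring_mat_def by auto
  then have "invertible_mat H" using Hc by (intro invertible_matI)
  moreover have "H * g = g * H"
  proof -
    have "(H * g) *\<^sub>v v = (g * H) *\<^sub>v v" if v: "v \<in> carrier_vec n" for v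
    proof -
      have gv: "g *\<^sub>v v \<in> carrier_vec n" "H *\<^sub>v v \<in> carrier_vec n" using g_carrier Hc v by auto
      have "poly_of (H *\<^sub>v displacement g v) = poly_of (displacement g (H *\<^sub>v v))"
        using S.isometriesD(5)[OF h, of "poly_of v"] v H disp_poly_of[OF v] disp_poly_of[OF gv(2)]
        by (simp add: disp_carrier)
      then have "H *\<^sub>v displacement g v = displacement g (H *\<^sub>v v)"
        using poly_of_inject[of "H *\<^sub>v displacement g v" n] Hc v gv disp_carrier by auto
      then have eq: "H *\<^sub>v v - H *\<^sub>v (g *\<^sub>v v) = H *\<^sub>v v - g *\<^sub>v (H *\<^sub>v v)"
        using Hc v gv by (simp add: displacement_def mult_minus_distrib_mat_vec[of H n n])
      have "H *\<^sub>v (g *\<^sub>v v) = g *\<^sub>v (H *\<^sub>v v)"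
      proof (rule eq_vecI)
        fix i assume "i < dim_vec (g *\<^sub>v (H *\<^sub>v v))"
        then have "i < n" using g_carrier by simp
        then show "(H *\<^sub>v (g *\<^sub>v v)) $ i = (g *\<^sub>v (H *\<^sub>v v)) $ i"
          using arg_cong[OF eq, of "\<lambda>x. x $ i"] Hc g_carrier by simp
      qed (use Hc g_carrier in simp)
      then show ?thesis
        using Hc g_carrier v by (simp add: assoc_mult_mat_vec[of _ n n _ n])
    qed
    then have eq: "((H * g) *\<^sub>v unit_vec n j) $ i = ((g * H) *\<^sub>v unit_vec n j) $ i" for i j
      by (simp only: unit_vec_carrier)
    have entry: "(M *\<^sub>v unit_vec n j) $ i = M $$ (i, j)"
      if "M \<in> carrier_mat n n" "i < n" "j < n" for M :: "'a mat" and i j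
      using that by simp
    have "(H * g) $$ (i, j) = (g * H) $$ (i, j)" if "i < n" "j < n" for i j
      using eq[of j i] that Hc g_carrier entry[of "H * g" i j] entry[of "g * H" i j]
      by (simp only: mult_carrier_mat)
    then show ?thesis
      using Hc g_carrier by (intro eq_matI) (simp_all only: carrier_matD index_mult_mat)
  qed
  ultimately have "H \<in> centr"
    using Hc iso by (simp add: centr_def unitary_group_carrier)
  then show ?thesis using H that by blast
qed

definition vec_invariant :: "'a vec \<Rightarrow> nat \<times> 'a" where
  "vec_invariant v = S.invariant (poly_of v)"

lemma vec_invariant_eq_iff:
  assumes v: "v \<in> carrier_vec n" and w: "w \<in> carrier_vec n"
  shows "vec_invariant v = vec_invariant w \<longleftrightarrow>
    (\<exists>h\<in>centr. \<exists>z\<in>carrier_vec n. h *\<^sub>v v = w + displacement g z)"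
proof -
  have "vec_invariant v = vec_invariant w \<longleftrightarrow> S.related (poly_of v) (poly_of w)"
    unfolding vec_invariant_def using S.related_iff_invariant v w by simp
  also have "\<dots> \<longleftrightarrow> (\<exists>h\<in>centr. \<exists>z\<in>carrier_vec n. h *\<^sub>v v = w + displacement g z)"
  proof
    assume "S.related (poly_of v) (poly_of w)"
    then obtain h p where h: "h \<in> S.isometries" "p \<in> poly_space n" "h (poly_of v) = poly_of w + disp p"
      by (auto simp: S.related_def)
    obtain z where z: "z \<in> carrier_vec n" "p = poly_of z" using h(2) by (auto simp: poly_space_eq)
    obtain H where H: "H \<in> centr" "poly_of (H *\<^sub>v v) = h (poly_of v)"
      using isometry_matrix[OF h(1)] v by blast
    have "poly_of (H *\<^sub>v v) = poly_of (w + displacement g z)"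
      using H h z w disp_carrier by (simp add: disp_poly_of poly_of_simps(1)[of _ n])
    then have "H *\<^sub>v v = w + displacement g z"
      using poly_of_inject[of "H *\<^sub>v v" n] centr_carrier[OF H(1)] v w z disp_carrier by auto
    then show "\<exists>h\<in>centr. \<exists>z\<in>carrier_vec n. h *\<^sub>v v = w + displacement g z" using H z by blast
  next
    assume "\<exists>h\<in>centr. \<exists>z\<in>carrier_vec n. h *\<^sub>v v = w + displacement g z"
    then obtain h z where h: "h \<in> centr" "z \<in> carrier_vec n" "h *\<^sub>v v = w + displacement g z" by blast
    show "S.related (poly_of v) (poly_of w)"
      using h v w disp_carrier
      by (intro S.relatedI[OF centr_isometry[OF h(1)], of "poly_of z"])
        (simp_all add: disp_poly_of poly_of_simps(1)[of _ n])
  qed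
  finally show ?thesis .
qed

section \<open>Cosets of \<open>[g,V]\<close> and their orbits\<close>

text \<open>The summands stand in the order in which right cosets unfold.\<close>

definition coset :: "'a vec \<Rightarrow> 'a vec set" where
  "coset v = (\<lambda>z. displacement g z + v) ` carrier_vec n"

lemma commutator_space_eq: "commutator_space n g = displacement g ` carrier_vec n"
  unfolding commutator_space_def
  using g_carrier by (intro image_cong) (auto simp: displacement_def minus_mult_distrib_mat_vec[of _ n n])

lemma coinvariants_eq: "coinvariants n g = coset ` carrier_vec n"
  unfolding coinvariants_def A_RCOSETS_def RCOSETS_def r_coset_def commutator_space_eq coset_def
  by (auto simp: module_vec_simps)

lemma coset_eqI:
  assumes "v \<in> carrier_vec n" "w \<in> carrier_vec n" "z \<in> carrier_vec n" "v = w + displacement g z"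
  shows "coset v = coset w"
proof -
  have neg: "displacement g (- z) = - displacement g z"
  proof -
    have "- u = (- 1) \<cdot>\<^sub>v u" for u :: "'a vec" by (intro eq_vecI) auto
    then show ?thesis using disp_linear(2)[OF assms(3), of "- 1"] by simp
  qed
  have dims: "dim_vec w = n" "dim_vec (displacement g z) = n"
    "t \<in> carrier_vec n \<Longrightarrow> dim_vec (displacement g t) = n" for t
    using assms(2) disp_carrier[OF assms(3)] disp_carrier[of t] by (auto dest: carrier_vecD)
  show ?thesis
  proof (intro equalityI subsetI)
    fix x assume "x \<in> coset v"
    then obtain t where t: "t \<in> carrier_vec n" "x = displacement g t + v" by (auto simp: coset_def)
    have "x = displacement g (t + z) + w"
      unfolding t(2) assms(4) disp_linear(1)[OF t(1) assms(3)]
      by (intro eq_vecI) (simp_all add: dims t(1))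
    then show "x \<in> coset w" using t assms by (auto simp: coset_def)
  next
    fix x assume "x \<in> coset w"
    then obtain t where t: "t \<in> carrier_vec n" "x = displacement g t + w" by (auto simp: coset_def)
    have "- z \<in> carrier_vec n" using assms(3) by simp
    then have "x = displacement g (t + - z) + v"
      unfolding t(2) assms(4) disp_linear(1)[OF t(1) \<open>- z \<in> carrier_vec n\<close>] neg
      by (intro eq_vecI) (simp_all add: dims t(1))
    then show "x \<in> coset v" using t assms by (auto simp: coset_def)
  qed
qed

lemma coset_self: "v \<in> carrier_vec n \<Longrightarrow> v \<in> coset v"
proof -
  assume v: "v \<in> carrier_vec n"
  have "displacement g (0\<^sub>v n) = 0\<^sub>v n" using g_carrier by (auto simp: displacement_def)
  then have "v = displacement g (0\<^sub>v n) + v" using v by simp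
  then show ?thesis unfolding coset_def by (rule image_eqI) simp
qed

text \<open>Since \<open>h\<close> is invertible and commutes with \<open>g\<close>, it maps
  \<open>[g,V]\<close> onto itself.\<close>

lemma centr_coset:
  assumes h: "h \<in> centr" and v: "v \<in> carrier_vec n"
  shows "(\<lambda>x. h *\<^sub>v x) ` coset v = coset (h *\<^sub>v v)"
proof -
  have hc: "h \<in> carrier_mat n n" by (rule centr_carrier[OF h])
  have "invertible_mat h" using h by (simp add: centr_def unitary_group_carrier)
  then obtain k where k: "k \<in> carrier_mat n n" "h * k = 1\<^sub>m n"
    using invertible_mat_obtain[OF hc] by blast
  have img: "h *\<^sub>v (displacement g z + v) = displacement g (h *\<^sub>v z) + h *\<^sub>v v" if "z \<in> carrier_vec n" for z
    using that v hc disp_carrier centr_disp[OF h] by (simp add: mult_add_distrib_mat_vec[of h n n])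
  have surj: "z = h *\<^sub>v (k *\<^sub>v z)" if "z \<in> carrier_vec n" for z
    using that hc k by (simp add: assoc_mult_mat_vec[symmetric, of _ n n _ n])
  show ?thesis
  proof (intro equalityI subsetI)
    fix x assume "x \<in> (\<lambda>x. h *\<^sub>v x) ` coset v"
    then obtain z where z: "z \<in> carrier_vec n" "x = displacement g (h *\<^sub>v z) + h *\<^sub>v v"
      using img by (auto simp: coset_def)
    moreover have "h *\<^sub>v z \<in> carrier_vec n" using hc z by simp
    ultimately show "x \<in> coset (h *\<^sub>v v)" unfolding coset_def by blast
  next
    fix x assume "x \<in> coset (h *\<^sub>v v)"
    then obtain z where z: "z \<in> carrier_vec n" "x = displacement g z + h *\<^sub>v v" by (auto simp: coset_def)
    have kz: "k *\<^sub>v z \<in> carrier_vec n" using k z by simp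
    then have "x = h *\<^sub>v (displacement g (k *\<^sub>v z) + v)" using img[OF kz] surj[OF z(1)] z(2) by simp
    then show "x \<in> (\<lambda>x. h *\<^sub>v x) ` coset v" using kz unfolding coset_def by blast
  qed
qed

definition orb :: "'a vec \<Rightarrow> 'a vec set set" where
  "orb v = {coset (h *\<^sub>v v) | h. h \<in> centr}"

lemma centralizer_orbits_eq: "centralizer_orbits n f g = orb ` carrier_vec n"
proof -
  define F where "F = orbit ((unitary_group n f)\<lparr>carrier := centralizer (unitary_group n f) g\<rparr>)
      (\<lambda>h. \<lambda>X\<in>coinvariants n g. (\<lambda>v. h *\<^sub>v v) ` X)"
  have "F (coset v) = orb v" if v: "v \<in> carrier_vec n" for v
  proof -
    have "coset v \<in> coinvariants n g" using v by (simp add: coinvariants_eq)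
    then show ?thesis
      using centr_coset[OF _ v] by (auto simp: F_def orbit_def orb_def centr_eq[symmetric])
  qed
  then have "F ` coinvariants n g = orb ` carrier_vec n"
    unfolding coinvariants_eq image_image by (intro image_cong) auto
  then show ?thesis
    unfolding centralizer_orbits_def orbits_def F_def[symmetric] by (simp add: setcompr_eq_image)
qed

text \<open>The right-hand side involves \<open>v\<close> only through its invariant, so vectors
  with equal invariants have equal orbits at once.\<close>

lemma orb_eq:
  assumes v: "v \<in> carrier_vec n"
  shows "orb v = {coset w | w. w \<in> carrier_vec n \<and> vec_invariant v = vec_invariant w}"
proof (intro equalityI subsetI)
  fix X assume "X \<in> orb v"
  then obtain h where h: "h \<in> centr" "X = coset (h *\<^sub>v v)" by (auto simp: orb_def)
  have hv: "h *\<^sub>v v \<in> carrier_vec n" using centr_carrier[OF h(1)] v by simp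
  have "displacement g (0\<^sub>v n) = 0\<^sub>v n" using g_carrier by (auto simp: displacement_def)
  then have "h *\<^sub>v v = h *\<^sub>v v + displacement g (0\<^sub>v n)" using hv by simp
  then have "vec_invariant v = vec_invariant (h *\<^sub>v v)"
    using vec_invariant_eq_iff[OF v hv] h(1) by (metis zero_carrier_vec)
  then show "X \<in> {coset w | w. w \<in> carrier_vec n \<and> vec_invariant v = vec_invariant w}"
    using h hv by blast
next
  fix X assume "X \<in> {coset w | w. w \<in> carrier_vec n \<and> vec_invariant v = vec_invariant w}"
  then obtain w where w: "w \<in> carrier_vec n" "X = coset w" "vec_invariant v = vec_invariant w" by blast
  obtain h z where h: "h \<in> centr" "z \<in> carrier_vec n" "h *\<^sub>v v = w + displacement g z"
    using vec_invariant_eq_iff[OF v w(1)] w(3) by blast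
  have "coset (h *\<^sub>v v) = coset w"
    using coset_eqI[OF _ w(1) h(2,3)] centr_carrier[OF h(1)] v by simp
  then have "X = coset (h *\<^sub>v v)" using w by simp
  then show "X \<in> orb v" unfolding orb_def using h(1) by blast
qed

lemma orb_eq_iff:
  assumes v: "v \<in> carrier_vec n" and w: "w \<in> carrier_vec n"
  shows "orb v = orb w \<longleftrightarrow> vec_invariant v = vec_invariant w"
proof
  assume "orb v = orb w"
  moreover have "coset v \<in> orb v" unfolding orb_eq[OF v] using v by blast
  ultimately obtain x where x: "x \<in> carrier_vec n" "coset v = coset x" "vec_invariant w = vec_invariant x"
    unfolding orb_eq[OF w] by blast
  obtain z where z: "z \<in> carrier_vec n" "v = displacement g z + x"
    using coset_self[OF v] unfolding x(2) by (auto simp: coset_def)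
  \<comment> \<open>Equality of the cosets of \<open>v\<close> and \<open>x\<close> is the relation
    of \<open>vec_invariant_eq_iff\<close> with the identity matrix.\<close>
  have "1\<^sub>m n \<in> centr"
    using group.subgroup_self[OF group_unitary_group, of n f, THEN subgroup.one_closed] g_carrier
    by (simp add: centr_def unitary_group_def)
  moreover have "1\<^sub>m n *\<^sub>v v = x + displacement g z"
    using v x z disp_carrier[OF z(1)] by (simp add: comm_add_vec[of x n])
  ultimately have "vec_invariant v = vec_invariant x"
    using vec_invariant_eq_iff[OF v x(1)] z(1) by blast
  then show "vec_invariant v = vec_invariant w" using x(3) by simp
qed (simp add: orb_eq v w)

lemma card_centralizer_orbits:
  assumes ks: "jordan_blocks_at g 1 ks"
  shows "int (card (centralizer_orbits n f g)) =
    1 + int q * int (distinct_parts (mset ks)) - int (simple_parts (mset ks))"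
proof -
  let ?m = "count (mset ks)"
  have pos: "0 < i" if "i \<in> set ks" for i
    using ks that by (metis jordan_blocks_at_def gr0I)
  have parts: "{i. 0 < i \<and> 0 < ?m i} = set ks"
    using pos by auto
  have simple: "{i. 0 < i \<and> ?m i = 1} = {k \<in> set_mset (mset ks). ?m k = 1}"
    using pos by (auto simp: count_eq_zero_iff) (metis One_nat_def count_eq_zero_iff nat.simps(3) set_mset_mset)
  have "card (centralizer_orbits n f g) = card (vec_invariant ` carrier_vec n)"
    unfolding centralizer_orbits_eq by (rule card_image_cong_fibres) (rule orb_eq_iff)
  also have "vec_invariant ` carrier_vec n = S.invariant ` poly_space n"
    by (simp add: vec_invariant_def poly_space_eq image_image)
  finally show ?thesis
    using S.card_invariant_image[of ?m] card_K_rad[OF ks] unfolding parts simple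
    by (simp add: distinct_parts_def simple_parts_def)
qed

end

theorem theorem4p1:
  fixes q n :: nat
    and f :: "'a::{field,finite} vec \<Rightarrow> 'a vec \<Rightarrow> 'a"
    and C :: "'a mat set"
    and g :: "'a mat"
  assumes "primepow q"
    and "card (UNIV :: 'a set) = q ^ 2"
    and "n \<ge> 1"
    and "hermitian_form q n f"
    and "nondegenerate_form n f"
    and "C \<in> conjugacy_classes (unitary_group n f)"
    and "g \<in> C"
  shows "int (card (centralizer_orbits n f g)) =
    1 + int q * int (distinct_parts (jordan_partition g 1))
      - int (simple_parts (jordan_partition g 1))"
proof -
  have "g \<in> carrier (unitary_group n f)"
    using group_unitary_group assms(6,7) by (rule conjugacy_class_carrier)
  then interpret unitary_element q n f g
    using assms by unfold_locales
  obtain ks where "jordan_partition g 1 = mset ks" "jordan_blocks_at g 1 ks"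
    using jordan_partition_eq[OF g_carrier] by blast
  then show ?thesis using card_centralizer_orbits by simp
qed


end
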